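(* Let $d\in\mathbb N$, $1\le p<\infty$, $1\le v<\infty$, and let $Y_1,Y_2,\dots$ be i.i.d. with law $P_0\in\mathcal P_d$. Suppose $$k_n=\begin{cases} n^{1/(2v)} & d\le 2v,\\ n^{1/d} & d>2v,\end{cases}$$ and let $K_n=\lceil \log_2 k_n\rceil$, $b_n=2^{K_n}$. Suppose the prior concentrations satisfy $\alpha_{\mathbf j,b_n}\ge 0$ for all $n$ and all $\mathbf j\in[b_n]^d$, and that there is a constant $A>0$ (not depending on $n$) such that for all $n$ $$\sum_{\mathbf j\in[b_n]^d}\alpha_{\mathbf j,b_n}\le \begin{cases} A\,n^{1/2} & d\le 2v,\\ A\,n^{1-v/d} & d>2v.\end{cases}$$ Then there exist constants $C>0$ and $N\in\mathbb N$ not depending on $n$ such that for all $n\ge N$, $$\mathbb E_{P_0} W_v(P_0,\bar P_n)\le \begin{cases} C\,n^{-1/(2v)} & d<2v,\\ C\,n^{-1/(2v)}\log^{1/v}(n) & d=2v,\\ C\,n^{-1/d} & d>2v,\end{cases}$$ where the expectation is over $Y_1,\dots,Y_n$.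
   Context: The space is $[0,1)^d$ with metric $\|x-y\|_p=(\sum_{i=1}^d|x_i-y_i|^p)^{1/p}$; $\mathcal P_d$ denotes the set of Borel probability measures on $[0,1)^d$. For $\mu,\nu\in\mathcal P_d$, $W_v(\mu,\nu)=\big(\inf_{\pi}\int\|x-y\|_p^v\,d\pi(x,y)\big)^{1/v}$, the infimum over couplings $\pi$ of $\mu$ and $\nu$. For $b\in\mathbb N$ write $[b]=\{1,\dots,b\}$ and, for a multi-index $\mathbf i=(i_1,\dots,i_d)\in[b]^d$, $A_{\mathbf i,b}=\prod_{l=1}^d\big[\tfrac{i_l-1}{b},\tfrac{i_l}{b}\big)$ (these cells partition $[0,1)^d$). For a weight vector $\boldsymbol\pi=(\pi_{\mathbf i})_{\mathbf i\in[b]^d}$ with $\pi_{\mathbf i}\ge0$, $\sum\pi_{\mathbf i}=1$, the histogram measure $\psi_b(\boldsymbol\pi)=\mathrm{Histogram}(\cdot\mid\boldsymbol\pi,b)$ is the probability measure with Lebesgue density $\sum_{\mathbf i\in[b]^d} b^d\pi_{\mathbf i}\mathbb I(y\in A_{\mathbf i,b})$. Given prior concentrations $\alpha_{\mathbf i,b_n}\ge0$, the posterior concentrations are $\alpha^*_{\mathbf i,b_n}=\alpha_{\mathbf i,b_n}+\sum_{t=1}^n\mathbb I(Y_t\in A_{\mathbf i,b_n})$, and the (posterior mean) histogram estimator is $\bar P_n=\psi_{b_n}\big((\alpha^*_{\mathbf i,b_n}/\sum_{\mathbf j\in[b_n]^d}\alpha^*_{\mathbf j,b_n})_{\mathbf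 i\in[b_n]^d}\big)$. *)

theory Defs
  imports "HOL-Probability.Probability"
begin

definition unit_cube :: "(real^'d) set" where
  "unit_cube = {x. \<forall>l. 0 \<le> x$l \<and> x$l < 1}"

definition prob_on_cube :: "(real^'d) measure \<Rightarrow> bool" where
  "prob_on_cube \<mu> \<longleftrightarrow> sets \<mu> = sets borel \<and> prob_space \<mu> \<and> emeasure \<mu> (UNIV - unit_cube) = 0"

definition pdist :: "real \<Rightarrow> real^'d \<Rightarrow> real^'d \<Rightarrow> real" where
  "pdist p x y = (\<Sum>l\<in>UNIV. \<bar>x$l - y$l\<bar> powr p) powr (1/p)"

definition couplings :: "(real^'d) measure \<Rightarrow> (real^'d) measure \<Rightarrow> ((real^'d) \<times> (real^'d)) measure set" where
  "couplings \<mu> \<nu> = {\<pi>. prob_space \<pi> \<and> sets \<pi> = sets (borel \<Otimes>\<^sub>M borel)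
       \<and> distr \<pi> borel fst = \<mu> \<and> distr \<pi> borel snd = \<nu>}"

definition wasserstein :: "real \<Rightarrow> real \<Rightarrow> (real^'d) measure \<Rightarrow> (real^'d) measure \<Rightarrow> real" where
  "wasserstein p v \<mu> \<nu> =
     (enn2real (INF \<pi> \<in> couplings \<mu> \<nu>. \<integral>\<^sup>+ z. ennreal (pdist p (fst z) (snd z) powr v) \<partial>\<pi>)) powr (1/v)"

definition multi_idx :: "nat \<Rightarrow> ('d::finite \<Rightarrow> nat) set" where
  "multi_idx b = {i. \<forall>l. 1 \<le> i l \<and> i l \<le> b}"

definition cell :: "('d \<Rightarrow> nat) \<Rightarrow> nat \<Rightarrow> (real^'d) set" where
  "cell i b = {x. \<forall>l. (real (i l) - 1) / real b \<le> x$l \<and> x$l < real (i l) / real b}"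

definition histogram :: "nat \<Rightarrow> (('d::finite \<Rightarrow> nat) \<Rightarrow> real) \<Rightarrow> (real^'d) measure" where
  "histogram b w = density lborel
     (\<lambda>y. ennreal (\<Sum>i\<in>multi_idx b. real b ^ CARD('d) * w i * indicator (cell i b) y))"

text \<open>Posterior concentrations and posterior-mean histogram estimator with bin number b,
  prior concentrations al, observations Y 1, ..., Y n.\<close>
definition post_conc :: "nat \<Rightarrow> (('d::finite \<Rightarrow> nat) \<Rightarrow> real) \<Rightarrow> (nat \<Rightarrow> real^'d) \<Rightarrow> nat \<Rightarrow> ('d \<Rightarrow> nat) \<Rightarrow> real" where
  "post_conc b al Y n i = al i + real (card {t\<in>{1..n}. Y t \<in> cell i b})"

definition hist_estimator :: "nat \<Rightarrow> (('d::finite \<Rightarrow> nat) \<Rightarrow> real) \<Rightarrow> (nat \<Rightarrow> real^'d) \<Rightarrow> nat \<Rightarrow> (real^'d) measure" where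
  "hist_estimator b al Y n = histogram b
     (\<lambda>i. post_conc b al Y n i / (\<Sum>j\<in>multi_idx b. post_conc b al Y n j))"

definition k_seq :: "nat \<Rightarrow> real \<Rightarrow> nat \<Rightarrow> real" where
  "k_seq d w n = (if real d \<le> 2 * w then real n powr (1 / (2 * w)) else real n powr (1 / real d))"

definition b_seq :: "nat \<Rightarrow> real \<Rightarrow> nat \<Rightarrow> nat" where
  "b_seq d v n = 2 ^ nat \<lceil>log 2 (k_seq d v n)\<rceil>"

end

(* Every histogram with 2 ^ K bins per axis is compared with P0 along the dyadic tree: mass is matched
   greedily, first inside the finest cells, then inside their parents, and so on.  The mass moved
   inside cells of width 2 ^ -k is then at most half the total discrepancy of the two measures over
   the cells of the next finer level, which gives
     W_v ^ v <= d ^ v * (2 ^ (-K v) + (SUM k<K. 2 ^ (-k v) * (SUM Q of level k+1. |P0 Q - P Q|) / 2)).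
   For the estimator, the empirical part of the inner sum has expectation at most
   sqrt (2 ^ ((k+1) d) / n) by the variance bound, and the prior contributes at most twice its total
   mass divided by n.  Summing the geometric series in the three regimes gives the rates. *)

theory Submission
  imports Defs
begin

text \<open>The factor 1/2 arises as follows: once a class is matched as far as possible, only one
  of the two measures has mass left in it, and that leftover is the discrepancy of the class. A unit
  moved one level further up uses one unit of leftover on each side. The code counts levels upwards
  from the finest cells, so its height \<open>l\<close> is depth \<open>K - l\<close> in the tree.

  With a discrepancy of order sqrt (2 ^ ((k+1) d) / n) at depth k + 1, the term of index k is a
  constant times n powr (-1/2) * r ^ k with r = 2 powr (d/2 - v). The regimes are r < 1, r = 1 and r
  > 1, where the sum over k < K has order 1, K and r ^ K. The choice of \<open>k_seq\<close> makes
  the cost 2 ^ (-K v) of moving mass inside the finest cells of no larger order, and the permitted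
  prior mass divided by n is of no larger order either.

  The distance is not shown to be measurable in the sample. It is therefore dominated almost surely
  by the root of an integrable function of finitely many cell counts, quadratic in the empirical
  deviations, and second moments suffice.\<close>

subsection \<open>Matching along nested partitions\<close>

text \<open>A partial transport plan that stays inside the classes of \<open>f\<close> and is
  maximal there: by the last clause, each class has one side used up completely. This is the
  invariant of the bottom-up induction.\<close>

definition class_matching :: "'i set \<Rightarrow> ('i \<Rightarrow> real) \<Rightarrow> ('i \<Rightarrow> real) \<Rightarrow> ('i \<Rightarrow> 'q) \<Rightarrow> ('i \<Rightarrow> 'i \<Rightarrow> real) \<Rightarrow> bool"
  where "class_matching I a c f w \<longleftrightarrow> (\<forall>i\<in>I. \<forall>j\<in>I. 0 \<le> w i j \<and> (f i \<noteq> f j \<longrightarrow> w i j = 0))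
    \<and> (\<forall>i\<in>I. (\<Sum>j\<in>I. w i j) \<le> a i) \<and> (\<forall>j\<in>I. (\<Sum>i\<in>I. w i j) \<le> c j)
    \<and> (\<forall>q. (\<forall>i\<in>I. f i = q \<longrightarrow> (\<Sum>j\<in>I. w i j) = a i) \<or> (\<forall>j\<in>I. f j = q \<longrightarrow> (\<Sum>i\<in>I. w i j) = c j))"

lemma class_matchingD:
  assumes "class_matching I a c f w"
  shows "\<And>i j. i \<in> I \<Longrightarrow> j \<in> I \<Longrightarrow> 0 \<le> w i j"
    and "\<And>i j. i \<in> I \<Longrightarrow> j \<in> I \<Longrightarrow> f i \<noteq> f j \<Longrightarrow> w i j = 0"
    and "\<And>i. i \<in> I \<Longrightarrow> (\<Sum>j\<in>I. w i j) \<le> a i"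
    and "\<And>j. j \<in> I \<Longrightarrow> (\<Sum>i\<in>I. w i j) \<le> c j"
    and "\<And>q. (\<forall>i\<in>I. f i = q \<longrightarrow> (\<Sum>j\<in>I. w i j) = a i) \<or> (\<forall>j\<in>I. f j = q \<longrightarrow> (\<Sum>i\<in>I. w i j) = c j)"
  using assms unfolding class_matching_def by blast+

text \<open>Inside each class take the product plan, divided by the larger of the two class masses.
  Row and column sums are then scaled by a factor at most 1, and the factor is 1 on the side with
  the smaller mass, which is thus exhausted.\<close>

lemma class_matching_exists:
  fixes a c :: "'i \<Rightarrow> real" and f :: "'i \<Rightarrow> 'q"
  assumes I: "finite I" and a: "\<And>i. i \<in> I \<Longrightarrow> 0 \<le> a i" and c: "\<And>i. i \<in> I \<Longrightarrow> 0 \<le> c i"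
  shows "\<exists>w. class_matching I a c f w"
proof -
  define S where "S u q = (\<Sum>i\<in>{i\<in>I. f i = q}. u i)" for u :: "'i \<Rightarrow> real" and q
  define m where "m q = max (S a q) (S c q)" for q
  define w where "w i j = (if f i = f j then a i * c j / m (f i) else 0)" for i j
  have S0: "0 \<le> S a q" "0 \<le> S c q" for q
    using a c by (auto simp: S_def intro!: sum_nonneg)
  have m0: "0 \<le> m q" for q using S0[of q] by (auto simp: m_def)
  have row: "(\<Sum>j\<in>I. w i j) = a i * (S c (f i) / m (f i))" for i
  proof -
    have "(\<Sum>j\<in>I. w i j) = (\<Sum>j\<in>{j\<in>I. f j = f i}. a i * c j / m (f i))"
      unfolding w_def using I by (subst sum.inter_filter) (auto intro!: sum.cong)
    then show ?thesis by (simp add: S_def sum_distrib_left sum_divide_distrib)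
  qed
  have col: "(\<Sum>i\<in>I. w i j) = c j * (S a (f j) / m (f j))" for j
  proof -
    have "(\<Sum>i\<in>I. w i j) = (\<Sum>i\<in>{i\<in>I. f i = f j}. a i * c j / m (f j))"
      unfolding w_def using I by (subst sum.inter_filter) (auto intro!: sum.cong)
    then show ?thesis by (simp add: S_def sum_distrib_left sum_divide_distrib mult.commute)
  qed
  \<comment> \<open>This includes \<open>m q = 0\<close>, where division by zero gives 0.\<close>
  have le1: "S a q / m q \<le> 1" "S c q / m q \<le> 1" for q
    using S0[of q] by (auto simp: m_def divide_le_eq)
  have zero: "u i = 0" if "S u (f i) = 0" "i \<in> I" "\<And>i. i \<in> I \<Longrightarrow> 0 \<le> u i" for u i
    using that I unfolding S_def by (subst (asm) sum_nonneg_eq_0_iff) auto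
  have m_zero: "S a q = 0" "S c q = 0" if "m q = 0" for q
    using that S0[of q] by (auto simp: m_def max_def split: if_splits)
  show ?thesis
    unfolding class_matching_def
  proof (intro exI[of _ w] conjI ballI allI impI)
    show "0 \<le> w i j" if "i \<in> I" "j \<in> I" for i j
      using that a c m0 by (auto simp: w_def)
    show "w i j = 0" if "i \<in> I" "j \<in> I" "f i \<noteq> f j" for i j using that by (simp add: w_def)
    show "(\<Sum>j\<in>I. w i j) \<le> a i" if "i \<in> I" for i
      unfolding row using a[OF that] le1(2)[of "f i"] mult_left_le by blast
    show "(\<Sum>i\<in>I. w i j) \<le> c j" if "j \<in> I" for j
      unfolding col using c[OF that] le1(1)[of "f j"] mult_left_le by blast
    show "(\<forall>i\<in>I. f i = q \<longrightarrow> (\<Sum>j\<in>I. w i j) = a i) \<or>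
      (\<forall>j\<in>I. f j = q \<longrightarrow> (\<Sum>i\<in>I. w i j) = c j)" for q
    \<comment> \<open>If the mass of \<open>c\<close> is the larger one, all of \<open>a\<close> is
      used in the class, otherwise all of \<open>c\<close>. In a class with \<open>m q = 0\<close>
      both functions vanish, so either side is trivially exhausted.\<close>
    proof (cases "m q = S c q")
      case True
      have "a i * (S c (f i) / m (f i)) = a i" if "i \<in> I" "f i = q" for i
        using True zero[of a i] m_zero[of q] that a by (cases "m q = 0") auto
      then show ?thesis unfolding row by blast
    next
      case False
      then have *: "m q = S a q" by (auto simp: m_def)
      have "c j * (S a (f j) / m (f j)) = c j" if "j \<in> I" "f j = q" for j
        using * zero[of c j] m_zero[of q] that c by (cases "m q = 0") auto
      then show ?thesis unfolding col by blast
    qed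
  qed
qed

text \<open>Greedy bottom-up matching along a nested sequence of partitions: as much mass as possible is
  matched inside the classes of level \<open>0\<close>, then the rest inside those of level \<open>1\<close>, and so on.
  After level \<open>m\<close> the unmatched mass of a class \<open>q\<close> is one-sided, hence equal to
  \<open>\<bar>a(q) - c(q)\<bar>\<close>.\<close>

lemma partial_matching:
  fixes a c :: "'i \<Rightarrow> real" and g :: "nat \<Rightarrow> 'i \<Rightarrow> 'q" and D :: "'i \<Rightarrow> 'i \<Rightarrow> real"
  assumes I: "finite I" and a: "\<And>i. i \<in> I \<Longrightarrow> 0 \<le> a i" and c: "\<And>i. i \<in> I \<Longrightarrow> 0 \<le> c i"
    and e: "\<And>l. 0 \<le> e l"
    and nested: "\<And>l i j. i \<in> I \<Longrightarrow> j \<in> I \<Longrightarrow> g l i = g l j \<Longrightarrow> g (Suc l) i = g (Suc l) j"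
    and D: "\<And>l i j. i \<in> I \<Longrightarrow> j \<in> I \<Longrightarrow> g l i = g l j \<Longrightarrow> D i j \<le> e l"
  shows "\<exists>w. class_matching I a c (g m) w
    \<and> (\<Sum>i\<in>I. \<Sum>j\<in>I. w i j * D i j) \<le> e 0 * sum a I +
        (\<Sum>l<m. e (Suc l) * ((\<Sum>q\<in>g l ` I. \<bar>\<Sum>i\<in>{i\<in>I. g l i = q}. a i - c i\<bar>) / 2))"
proof (induction m)
  case 0
  obtain w where cm: "class_matching I a c (g 0) w"
    using class_matching_exists[of I a c, OF I a c] by blast
  note w = class_matchingD[OF cm]
  \<comment> \<open>No discrepancy enters at the finest level: the plan moves at most the total
    mass, at cost at most \<open>e 0\<close> per unit.\<close>
  have "(\<Sum>i\<in>I. \<Sum>j\<in>I. w i j * D i j) \<le> (\<Sum>i\<in>I. \<Sum>j\<in>I. w i j * e 0)"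
  proof (intro sum_mono)
    fix i j assume ij: "i \<in> I" "j \<in> I"
    show "w i j * D i j \<le> w i j * e 0"
      using w(1)[OF ij] w(2)[OF ij] D[OF ij, of 0] by (cases "g 0 i = g 0 j") (auto intro: mult_left_mono)
  qed
  also have "\<dots> = e 0 * (\<Sum>i\<in>I. \<Sum>j\<in>I. w i j)"
    by (simp add: sum_distrib_left mult.commute)
  also have "\<dots> \<le> e 0 * sum a I"
    using w(3) e by (intro mult_left_mono sum_mono) auto
  finally show ?case using cm by (intro exI[of _ w]) simp
next
  case (Suc m)
  then obtain w where cm: "class_matching I a c (g m) w"
    and w_cost: "(\<Sum>i\<in>I. \<Sum>j\<in>I. w i j * D i j) \<le> e 0 * sum a I +
        (\<Sum>l<m. e (Suc l) * ((\<Sum>q\<in>g l ` I. \<bar>\<Sum>i\<in>{i\<in>I. g l i = q}. a i - c i\<bar>) / 2))"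
    by blast
  note w = class_matchingD[OF cm]
  define a' where "a' i = a i - (\<Sum>j\<in>I. w i j)" for i
  define c' where "c' j = c j - (\<Sum>i\<in>I. w i j)" for j
  have a'0: "0 \<le> a' i" if "i \<in> I" for i using w(3)[OF that] by (simp add: a'_def)
  have c'0: "0 \<le> c' i" if "i \<in> I" for i using w(4)[OF that] by (simp add: c'_def)
  obtain u where "class_matching I a' c' (g (Suc m)) u"
    using class_matching_exists[of I a' c', OF I a'0 c'0] by blast
  note u = class_matchingD[OF this]
  \<comment> \<open>As \<open>w\<close> does not leave the class, it removes the same mass from both
    sides, so the signed difference of the leftovers is that of \<open>a\<close> and
    \<open>c\<close>. By maximality one leftover vanishes, so their sum is the absolute value of
    this difference.\<close>
  have left: "(\<Sum>i\<in>{i\<in>I. g m i = q}. a' i + c' i) = \<bar>\<Sum>i\<in>{i\<in>I. g m i = q}. a i - c i\<bar>" for q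
  proof -
    let ?Q = "{i\<in>I. g m i = q}"
    have w0: "w i j = 0" "w j i = 0" if "i \<in> ?Q" "j \<in> I - ?Q" for i j
      using that w(2)[of i j] w(2)[of j i] by auto
    have "(\<Sum>i\<in>?Q. \<Sum>j\<in>I. w i j) = (\<Sum>i\<in>?Q. \<Sum>j\<in>?Q. w i j)"
      by (rule sum.cong[OF refl], rule sum.mono_neutral_right) (use I w0 in auto)
    also have "\<dots> = (\<Sum>j\<in>?Q. \<Sum>i\<in>?Q. w i j)" by (rule sum.swap)
    also have "\<dots> = (\<Sum>j\<in>?Q. \<Sum>i\<in>I. w i j)"
      by (rule sum.cong[OF refl], rule sum.mono_neutral_left) (use I w0 in auto)
    finally have bal: "(\<Sum>i\<in>?Q. a' i - c' i) = (\<Sum>i\<in>?Q. a i - c i)"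
      by (simp add: a'_def c'_def sum_subtractf)
    from w(5)[of q] show ?thesis
    proof
      assume "\<forall>i\<in>I. g m i = q \<longrightarrow> (\<Sum>j\<in>I. w i j) = a i"
      then have *: "a' i = 0" if "i \<in> ?Q" for i using that by (simp add: a'_def)
      have "(\<Sum>i\<in>?Q. a' i + c' i) = (\<Sum>i\<in>?Q. c' i)" using * by simp
      moreover have "(\<Sum>i\<in>?Q. a' i - c' i) = - (\<Sum>i\<in>?Q. c' i)" using * by (simp add: sum_negf)
      moreover have "(\<Sum>i\<in>?Q. c' i) \<ge> 0" using c'0 by (auto intro: sum_nonneg)
      ultimately show ?thesis using bal by linarith
    next
      assume "\<forall>j\<in>I. g m j = q \<longrightarrow> (\<Sum>i\<in>I. w i j) = c j"
      then have *: "c' i = 0" if "i \<in> ?Q" for i using that by (simp add: c'_def)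
      have "(\<Sum>i\<in>?Q. a' i + c' i) = (\<Sum>i\<in>?Q. a' i)" using * by simp
      moreover have "(\<Sum>i\<in>?Q. a' i - c' i) = (\<Sum>i\<in>?Q. a' i)" using * by simp
      moreover have "(\<Sum>i\<in>?Q. a' i) \<ge> 0" using a'0 by (auto intro: sum_nonneg)
      ultimately show ?thesis using bal by linarith
    qed
  qed
  \<comment> \<open>Each unit of \<open>u\<close> is charged to the leftover of \<open>a\<close> and
    to that of \<open>c\<close>, whence the 2.\<close>
  have "2 * (\<Sum>i\<in>I. \<Sum>j\<in>I. u i j) \<le> (\<Sum>i\<in>I. a' i + c' i)"
  proof -
    have "(\<Sum>i\<in>I. \<Sum>j\<in>I. u i j) \<le> (\<Sum>i\<in>I. a' i)" using u(3) by (rule sum_mono)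
    moreover have "(\<Sum>j\<in>I. \<Sum>i\<in>I. u i j) \<le> (\<Sum>j\<in>I. c' j)" using u(4) by (rule sum_mono)
    moreover have "(\<Sum>i\<in>I. \<Sum>j\<in>I. u i j) = (\<Sum>j\<in>I. \<Sum>i\<in>I. u i j)" by (rule sum.swap)
    ultimately show ?thesis by (simp add: sum.distrib)
  qed
  also have "(\<Sum>i\<in>I. a' i + c' i) = (\<Sum>q\<in>g m ` I. \<bar>\<Sum>i\<in>{i\<in>I. g m i = q}. a i - c i\<bar>)"
    unfolding left[symmetric] using I by (subst sum.group) auto
  finally have mass: "(\<Sum>i\<in>I. \<Sum>j\<in>I. u i j) \<le> (\<Sum>q\<in>g m ` I. \<bar>\<Sum>i\<in>{i\<in>I. g m i = q}. a i - c i\<bar>) / 2"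
    by linarith
  have "(\<Sum>i\<in>I. \<Sum>j\<in>I. u i j * D i j) \<le> (\<Sum>i\<in>I. \<Sum>j\<in>I. u i j * e (Suc m))"
  proof (intro sum_mono)
    fix i j assume ij: "i \<in> I" "j \<in> I"
    show "u i j * D i j \<le> u i j * e (Suc m)"
      using u(1)[OF ij] u(2)[OF ij] D[OF ij, of "Suc m"]
      by (cases "g (Suc m) i = g (Suc m) j") (auto intro: mult_left_mono)
  qed
  also have "\<dots> = e (Suc m) * (\<Sum>i\<in>I. \<Sum>j\<in>I. u i j)"
    by (simp add: sum_distrib_left mult.commute)
  also have "\<dots> \<le> e (Suc m) * ((\<Sum>q\<in>g m ` I. \<bar>\<Sum>i\<in>{i\<in>I. g m i = q}. a i - c i\<bar>) / 2)"
    using mass e by (rule mult_left_mono)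
  finally have cost: "(\<Sum>i\<in>I. \<Sum>j\<in>I. u i j * D i j) \<le> \<dots>" .
  \<comment> \<open>The two plans are added. Nestedness keeps \<open>w\<close> inside the coarser
    classes, and exhausting the leftovers by \<open>u\<close> amounts to exhausting \<open>a\<close>
    or \<open>c\<close> by \<open>w + u\<close>.\<close>
  show ?case
    unfolding class_matching_def
  proof (intro exI[of _ "\<lambda>i j. w i j + u i j"] conjI ballI allI impI)
    fix i j assume ij: "i \<in> I" "j \<in> I"
    show "0 \<le> w i j + u i j" using w(1) u(1) ij by simp
    assume "g (Suc m) i \<noteq> g (Suc m) j"
    then show "w i j + u i j = 0" using w(2)[OF ij] u(2)[OF ij] nested[OF ij, of m] by auto
  next
    show "(\<Sum>j\<in>I. w i j + u i j) \<le> a i" if "i \<in> I" for i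
      using u(3)[OF that] by (simp add: a'_def sum.distrib)
    show "(\<Sum>i\<in>I. w i j + u i j) \<le> c j" if "j \<in> I" for j
      using u(4)[OF that] by (simp add: c'_def sum.distrib)
    show "(\<forall>i\<in>I. g (Suc m) i = q \<longrightarrow> (\<Sum>j\<in>I. w i j + u i j) = a i) \<or>
      (\<forall>j\<in>I. g (Suc m) j = q \<longrightarrow> (\<Sum>i\<in>I. w i j + u i j) = c j)" for q
      using u(5)[of q] by (auto simp: a'_def c'_def sum.distrib)
    show "(\<Sum>i\<in>I. \<Sum>j\<in>I. (w i j + u i j) * D i j) \<le> e 0 * sum a I +
        (\<Sum>l<Suc m. e (Suc l) * ((\<Sum>q\<in>g l ` I. \<bar>\<Sum>i\<in>{i\<in>I. g l i = q}. a i - c i\<bar>) / 2))"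
      using w_cost cost by (simp add: distrib_right sum.distrib)
  qed
qed

text \<open>At height \<open>m\<close> there is only one class, so maximality exhausts one side
  altogether. Equal total masses then force the other side to be exhausted as well, and the partial
  plan is a coupling.\<close>

lemma tree_coupling:
  fixes a c :: "'i \<Rightarrow> real" and g :: "nat \<Rightarrow> 'i \<Rightarrow> 'q" and D :: "'i \<Rightarrow> 'i \<Rightarrow> real"
  assumes I: "finite I" and a: "\<And>i. i \<in> I \<Longrightarrow> 0 \<le> a i" and c: "\<And>i. i \<in> I \<Longrightarrow> 0 \<le> c i"
    and e: "\<And>l. 0 \<le> e l"
    and nested: "\<And>l i j. i \<in> I \<Longrightarrow> j \<in> I \<Longrightarrow> g l i = g l j \<Longrightarrow> g (Suc l) i = g (Suc l) j"
    and D: "\<And>l i j. i \<in> I \<Longrightarrow> j \<in> I \<Longrightarrow> g l i = g l j \<Longrightarrow> D i j \<le> e l"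
    and top: "\<And>i j. i \<in> I \<Longrightarrow> j \<in> I \<Longrightarrow> g m i = g m j"
    and eq: "sum a I = sum c I"
  shows "\<exists>w. (\<forall>i\<in>I. \<forall>j\<in>I. 0 \<le> w i j) \<and> (\<forall>i\<in>I. (\<Sum>j\<in>I. w i j) = a i) \<and> (\<forall>j\<in>I. (\<Sum>i\<in>I. w i j) = c j)
    \<and> (\<Sum>i\<in>I. \<Sum>j\<in>I. w i j * D i j) \<le> e 0 * sum a I +
        (\<Sum>l<m. e (Suc l) * ((\<Sum>q\<in>g l ` I. \<bar>\<Sum>i\<in>{i\<in>I. g l i = q}. a i - c i\<bar>) / 2))"
proof -
  obtain w where cm: "class_matching I a c (g m) w"
    and w_cost: "(\<Sum>i\<in>I. \<Sum>j\<in>I. w i j * D i j) \<le> e 0 * sum a I +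
        (\<Sum>l<m. e (Suc l) * ((\<Sum>q\<in>g l ` I. \<bar>\<Sum>i\<in>{i\<in>I. g l i = q}. a i - c i\<bar>) / 2))"
    using partial_matching[of I a c e g D m, OF I a c e nested D] by blast
  note w = class_matchingD[OF cm]
  have swap: "(\<Sum>i\<in>I. \<Sum>j\<in>I. w i j) = (\<Sum>j\<in>I. \<Sum>i\<in>I. w i j)" by (rule sum.swap)
  have tight: "(\<forall>i\<in>I. (\<Sum>j\<in>I. w i j) = a i) \<or> (\<forall>j\<in>I. (\<Sum>i\<in>I. w i j) = c j)"
  proof (cases "I = {}")
    case False
    then obtain i0 where "i0 \<in> I" by auto
    then show ?thesis using w(5)[of "g m i0"] top by blast
  qed auto
  have "(\<forall>i\<in>I. (\<Sum>j\<in>I. w i j) = a i) \<and> (\<forall>j\<in>I. (\<Sum>i\<in>I. w i j) = c j)"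
    using tight
  proof
    assume *: "\<forall>i\<in>I. (\<Sum>j\<in>I. w i j) = a i"
    then have "(\<Sum>j\<in>I. c j - (\<Sum>i\<in>I. w i j)) = 0" using swap eq by (simp add: sum_subtractf)
    then show ?thesis using * w(4) I by (subst (asm) sum_nonneg_eq_0_iff) auto
  next
    assume *: "\<forall>j\<in>I. (\<Sum>i\<in>I. w i j) = c j"
    then have "(\<Sum>i\<in>I. a i - (\<Sum>j\<in>I. w i j)) = 0" using swap eq by (simp add: sum_subtractf)
    then show ?thesis using * w(3) I by (subst (asm) sum_nonneg_eq_0_iff) auto
  qed
  then show ?thesis using w(1) w_cost by blast
qed

subsection \<open>Couplings from matrices\<close>

lemma pdist_measurable [measurable]:
  "(\<lambda>z. pdist p (fst z) (snd z)) \<in> borel_measurable (borel \<Otimes>\<^sub>M borel)"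
proof -
  have [measurable]: "(\<lambda>x::real^'d. x $ l) \<in> borel_measurable borel" for l
    by (intro borel_measurable_continuous_onI continuous_on_component continuous_on_id)
  show ?thesis unfolding pdist_def by measurable
qed

text \<open>The sharp factor d powr (1/p) is relaxed to d, so that no later constant depends on
  \<open>p\<close>.\<close>

lemma pdist_le:
  fixes x y :: "real^'d"
  assumes "1 \<le> p" and "0 \<le> r" and "\<And>l. \<bar>x$l - y$l\<bar> \<le> r"
  shows "pdist p x y \<le> real CARD('d) * r"
proof -
  have d: "1 \<le> real CARD('d)" by (simp add: Suc_leI)
  have "(\<Sum>l\<in>UNIV. \<bar>x$l - y$l\<bar> powr p) \<le> (\<Sum>l\<in>(UNIV::'d set). r powr p)"
    using assms by (intro sum_mono powr_mono2) auto
  also have "\<dots> = real CARD('d) * r powr p" by simp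
  finally have "pdist p x y \<le> (real CARD('d) * r powr p) powr (1/p)"
    unfolding pdist_def using assms by (intro powr_mono2) (auto intro: sum_nonneg)
  also have "\<dots> = real CARD('d) powr (1/p) * r"
    using assms by (simp add: powr_mult powr_powr)
  also have "\<dots> \<le> real CARD('d) powr 1 * r"
    using assms d by (intro mult_right_mono powr_mono) auto
  finally show ?thesis using d by simp
qed

text \<open>As \<open>enn2real\<close> sends infinity to 0, it is monotone only below a finite
  bound; the bound \<open>ennreal x\<close> supplies this.\<close>

lemma wasserstein_le_of_coupling:
  assumes "\<pi> \<in> couplings \<mu> \<nu>"
    and "(\<integral>\<^sup>+ z. ennreal (pdist p (fst z) (snd z) powr v) \<partial>\<pi>) \<le> ennreal x" and "0 \<le> x" and "1 \<le> v"
  shows "wasserstein p v \<mu> \<nu> \<le> x powr (1/v)"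
proof -
  have "(INF \<pi> \<in> couplings \<mu> \<nu>. \<integral>\<^sup>+ z. ennreal (pdist p (fst z) (snd z) powr v) \<partial>\<pi>) \<le> ennreal x"
    using assms(1,2) by (rule INF_lower2)
  then have "enn2real (INF \<pi> \<in> couplings \<mu> \<nu>. \<integral>\<^sup>+ z. ennreal (pdist p (fst z) (snd z) powr v) \<partial>\<pi>) \<le> x"
    using enn2real_mono[of _ "ennreal x"] assms(3) by fastforce
  then show ?thesis unfolding wasserstein_def using assms by (intro powr_mono2) auto
qed

text \<open>Evaluates step functions on a product grid. It serves twice for the lifted coupling: for
  its values on rectangles and for its transport cost.\<close>

lemma nn_integral_sum_rectangles:
  fixes \<mu> :: "'a measure" and \<nu> :: "'b measure"
  assumes \<mu>: "prob_space \<mu>" and \<nu>: "prob_space \<nu>"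
    and ST: "\<And>i. i \<in> I \<Longrightarrow> S i \<in> sets \<mu>" "\<And>j. j \<in> I \<Longrightarrow> T j \<in> sets \<nu>"
    and r: "\<And>i j. i \<in> I \<Longrightarrow> j \<in> I \<Longrightarrow> 0 \<le> r i j"
  shows "(\<integral>\<^sup>+z. (\<Sum>i\<in>I. \<Sum>j\<in>I. ennreal (r i j) * indicator (S i \<times> T j) z) \<partial>(\<mu> \<Otimes>\<^sub>M \<nu>))
    = ennreal (\<Sum>i\<in>I. \<Sum>j\<in>I. r i j * (measure \<mu> (S i) * measure \<nu> (T j)))"
proof -
  interpret \<mu>: prob_space \<mu> by fact
  interpret \<nu>: prob_space \<nu> by fact
  have m: "(\<lambda>z. ennreal (r i j) * indicator (S i \<times> T j) z) \<in> borel_measurable (\<mu> \<Otimes>\<^sub>M \<nu>)"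
    if "i \<in> I" "j \<in> I" for i j
  proof -
    have [measurable]: "S i \<times> T j \<in> sets (\<mu> \<Otimes>\<^sub>M \<nu>)" using ST that by (intro pair_measureI)
    show ?thesis by measurable
  qed
  have one: "(\<integral>\<^sup>+z. ennreal (r i j) * indicator (S i \<times> T j) z \<partial>(\<mu> \<Otimes>\<^sub>M \<nu>))
      = ennreal (r i j * (measure \<mu> (S i) * measure \<nu> (T j)))" if ij: "i \<in> I" "j \<in> I" for i j
  proof -
    have "(\<integral>\<^sup>+z. ennreal (r i j) * indicator (S i \<times> T j) z \<partial>(\<mu> \<Otimes>\<^sub>M \<nu>))
        = ennreal (r i j) * emeasure (\<mu> \<Otimes>\<^sub>M \<nu>) (S i \<times> T j)"
      using ST ij by (intro nn_integral_cmult_indicator pair_measureI)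
    also have "\<dots> = ennreal (r i j) * (emeasure \<mu> (S i) * emeasure \<nu> (T j))"
      using ST ij by (subst \<nu>.emeasure_pair_measure_Times) auto
    finally show ?thesis
      using r[OF ij] by (simp add: \<mu>.emeasure_eq_measure \<nu>.emeasure_eq_measure ennreal_mult)
  qed
  have "(\<integral>\<^sup>+z. (\<Sum>i\<in>I. \<Sum>j\<in>I. ennreal (r i j) * indicator (S i \<times> T j) z) \<partial>(\<mu> \<Otimes>\<^sub>M \<nu>))
      = (\<Sum>i\<in>I. \<integral>\<^sup>+z. (\<Sum>j\<in>I. ennreal (r i j) * indicator (S i \<times> T j) z) \<partial>(\<mu> \<Otimes>\<^sub>M \<nu>))"
    using m by (intro nn_integral_sum borel_measurable_sum)
  also have "\<dots> = (\<Sum>i\<in>I. \<Sum>j\<in>I. \<integral>\<^sup>+z. ennreal (r i j) * indicator (S i \<times> T j) z \<partial>(\<mu> \<Otimes>\<^sub>M \<nu>))"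
    using m by (intro sum.cong[OF refl] nn_integral_sum)
  also have "\<dots> = (\<Sum>i\<in>I. \<Sum>j\<in>I. ennreal (r i j * (measure \<mu> (S i) * measure \<nu> (T j))))"
    using one by simp
  also have "\<dots> = ennreal (\<Sum>i\<in>I. \<Sum>j\<in>I. r i j * (measure \<mu> (S i) * measure \<nu> (T j)))"
  proof -
    have "0 \<le> r i j * (measure \<mu> (S i) * measure \<nu> (T j))" if "i \<in> I" "j \<in> I" for i j
      using r[OF that] by simp
    then show ?thesis by (simp add: sum_nonneg)
  qed
  finally show ?thesis .
qed

text \<open>A discrete coupling \<open>w\<close> of the cell masses lifts to a coupling of the measures that has density
  \<open>w i j / (\<mu>(A i) \<nu>(A j))\<close> with respect to the product measure on \<open>A i \<times> A j\<close>.
  Cells of mass \<open>0\<close> are harmless, since \<open>w\<close> vanishes there.\<close>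

lemma coupling_of_matrix:
  fixes \<mu> \<nu> :: "(real^'d) measure" and A :: "'i \<Rightarrow> (real^'d) set"
  assumes \<mu>: "prob_space \<mu>" "sets \<mu> = sets borel" and \<nu>: "prob_space \<nu>" "sets \<nu> = sets borel"
    and I: "finite I" and disj: "disjoint_family_on A I"
    and A: "\<And>i. i \<in> I \<Longrightarrow> A i \<in> sets borel"
    and cover: "AE x in \<mu>. x \<in> (\<Union>i\<in>I. A i)" "AE x in \<nu>. x \<in> (\<Union>i\<in>I. A i)"
    and w: "\<And>i j. i \<in> I \<Longrightarrow> j \<in> I \<Longrightarrow> 0 \<le> w i j"
    and row: "\<And>i. i \<in> I \<Longrightarrow> (\<Sum>j\<in>I. w i j) = measure \<mu> (A i)"
    and col: "\<And>j. j \<in> I \<Longrightarrow> (\<Sum>i\<in>I. w i j) = measure \<nu> (A j)"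
    and h: "h \<in> borel_measurable (borel \<Otimes>\<^sub>M borel)"
    and D: "\<And>i j x y. i \<in> I \<Longrightarrow> j \<in> I \<Longrightarrow> x \<in> A i \<Longrightarrow> y \<in> A j \<Longrightarrow> h (x, y) \<le> ennreal (D i j)"
    and D0: "\<And>i j. i \<in> I \<Longrightarrow> j \<in> I \<Longrightarrow> 0 \<le> D i j"
  shows "\<exists>\<pi>\<in>couplings \<mu> \<nu>. (\<integral>\<^sup>+ z. h z \<partial>\<pi>) \<le> ennreal (\<Sum>i\<in>I. \<Sum>j\<in>I. w i j * D i j)"
proof -
  interpret \<mu>: prob_space \<mu> by fact
  interpret \<nu>: prob_space \<nu> by fact
  have sp: "space \<mu> = UNIV" "space \<nu> = UNIV"
    using sets_eq_imp_space_eq[OF \<mu>(2)] sets_eq_imp_space_eq[OF \<nu>(2)] by auto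
  define q where "q i j = w i j / (measure \<mu> (A i) * measure \<nu> (A j))" for i j
  have q0: "0 \<le> q i j" if "i \<in> I" "j \<in> I" for i j using w[OF that] by (simp add: q_def)
  have w_row0: "w i j = 0" if "i \<in> I" "j \<in> I" "measure \<mu> (A i) = 0" for i j
    using row[OF that(1)] that I w by (simp add: sum_nonneg_eq_0_iff)
  have w_col0: "w i j = 0" if "i \<in> I" "j \<in> I" "measure \<nu> (A j) = 0" for i j
    using col[OF that(2)] that I w by (simp add: sum_nonneg_eq_0_iff)
  \<comment> \<open>If one of the cells is null, its row or column of \<open>w\<close> sums to 0 and
    consists of zeros, so the identity survives the division by zero in \<open>q\<close>.\<close>
  have qw: "q i j * measure \<mu> (A i) * measure \<nu> (A j) = w i j" if "i \<in> I" "j \<in> I" for i j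
    using w_row0[OF that] w_col0[OF that] by (auto simp: q_def)
  have [simp]: "A i \<in> sets borel" "A i \<in> sets \<mu>" "A i \<in> sets \<nu>" if "i \<in> I" for i
    using A[OF that] \<mu> \<nu> by auto
  define g where "g z = (\<Sum>i\<in>I. \<Sum>j\<in>I. ennreal (q i j) * indicator (A i \<times> A j) z)" for z
  have sets_pair: "sets (\<mu> \<Otimes>\<^sub>M \<nu>) = sets (borel \<Otimes>\<^sub>M borel)"
    using \<mu> \<nu> by (intro sets_pair_measure_cong)
  have g[measurable]: "g \<in> borel_measurable (\<mu> \<Otimes>\<^sub>M \<nu>)"
    unfolding g_def
  proof (intro borel_measurable_sum)
    fix i j assume "i \<in> I" "j \<in> I"
    then have [measurable]: "A i \<times> A j \<in> sets (\<mu> \<Otimes>\<^sub>M \<nu>)" by (intro pair_measureI) auto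
    show "(\<lambda>z. ennreal (q i j) * indicator (A i \<times> A j) z) \<in> borel_measurable (\<mu> \<Otimes>\<^sub>M \<nu>)"
      by measurable
  qed
  define \<pi> where "\<pi> = density (\<mu> \<Otimes>\<^sub>M \<nu>) g"
  have sets_pi: "sets \<pi> = sets (borel \<Otimes>\<^sub>M borel)" by (simp add: \<pi>_def sets_pair)
  have space_pi: "space \<pi> = UNIV" using sets_eq_imp_space_eq[OF sets_pi] by (simp add: space_pair_measure)
  \<comment> \<open>Rectangles suffice, since each marginal only needs
    \<open>B \<times> UNIV\<close> or \<open>UNIV \<times> C\<close>.\<close>
  have rect: "emeasure \<pi> (B \<times> C) =
      ennreal (\<Sum>i\<in>I. \<Sum>j\<in>I. q i j * (measure \<mu> (A i \<inter> B) * measure \<nu> (A j \<inter> C)))"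
    if [measurable]: "B \<in> sets borel" "C \<in> sets borel" for B C
  proof -
    have BC: "B \<times> C \<in> sets (\<mu> \<Otimes>\<^sub>M \<nu>)" using that sets_pair by auto
    have "emeasure \<pi> (B \<times> C) = (\<integral>\<^sup>+z. g z * indicator (B \<times> C) z \<partial>(\<mu> \<Otimes>\<^sub>M \<nu>))"
      unfolding \<pi>_def using BC by (intro emeasure_density) auto
    also have "\<dots> = (\<integral>\<^sup>+z. (\<Sum>i\<in>I. \<Sum>j\<in>I. ennreal (q i j) * indicator ((A i \<inter> B) \<times> (A j \<inter> C)) z) \<partial>(\<mu> \<Otimes>\<^sub>M \<nu>))"
      unfolding g_def sum_distrib_right
      by (intro nn_integral_cong sum.cong refl) (auto split: split_indicator)
    also have "\<dots> = ennreal (\<Sum>i\<in>I. \<Sum>j\<in>I. q i j * (measure \<mu> (A i \<inter> B) * measure \<nu> (A j \<inter> C)))"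
      using A that \<mu> \<nu> q0 by (intro nn_integral_sum_rectangles) auto
    finally show ?thesis .
  qed
  have split: "(\<Sum>i\<in>I. measure \<rho> (A i \<inter> B)) = measure \<rho> B"
    if "prob_space \<rho>" "sets \<rho> = sets borel" "AE x in \<rho>. x \<in> (\<Union>i\<in>I. A i)" "B \<in> sets borel" for \<rho> B
  proof -
    interpret \<rho>: prob_space \<rho> by fact
    have "(\<Sum>i\<in>I. measure \<rho> (A i \<inter> B)) = measure \<rho> (\<Union>i\<in>I. A i \<inter> B)"
      using I A disj that
      by (intro \<rho>.finite_measure_finite_Union[symmetric]) (auto simp: disjoint_family_on_def)
    also have "\<dots> = measure \<rho> B"
    proof (rule \<rho>.finite_measure_eq_AE)
      show "AE x in \<rho>. x \<in> (\<Union>i\<in>I. A i \<inter> B) \<longleftrightarrow> x \<in> B"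
        using that(3) by eventually_elim auto
      show "B \<in> sets \<rho>" using that(2,4) by simp
      then show "(\<Union>i\<in>I. A i \<inter> B) \<in> sets \<rho>"
        using A that(2) by (intro sets.finite_UN sets.Int I) simp_all
    qed
    finally show ?thesis .
  qed
  \<comment> \<open>Summing over the columns turns row \<open>i\<close> into its row sum times the
    conditional mass of \<open>B\<close> in \<open>A i\<close>, that is, into the mass of
    \<open>A i \<inter> B\<close>. A null cell gives 0 on both sides.\<close>
  have fst: "emeasure \<pi> (B \<times> UNIV) = emeasure \<mu> B" if B: "B \<in> sets borel" for B
  proof -
    have "(\<Sum>j\<in>I. q i j * (measure \<mu> (A i \<inter> B) * measure \<nu> (A j))) = measure \<mu> (A i \<inter> B)"
      if i: "i \<in> I" for i
    proof (cases "measure \<mu> (A i) = 0")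
      case True
      have "measure \<mu> (A i \<inter> B) \<le> measure \<mu> (A i)"
        using i by (intro \<mu>.finite_measure_mono) auto
      then show ?thesis using True by (simp add: measure_le_0_iff)
    next
      case False
      have "(\<Sum>j\<in>I. q i j * (measure \<mu> (A i \<inter> B) * measure \<nu> (A j)))
          = (\<Sum>j\<in>I. measure \<mu> (A i \<inter> B) / measure \<mu> (A i) * w i j)"
        using False by (intro sum.cong refl) (simp add: qw[OF i, symmetric])
      also have "\<dots> = measure \<mu> (A i \<inter> B)"
        unfolding sum_distrib_left[symmetric] row[OF i] using False by simp
      finally show ?thesis .
    qed
    then show ?thesis using rect[OF B, of UNIV] split[OF \<mu> cover(1) B]
      by (simp add: \<mu>.emeasure_eq_measure)
  qed
  have snd: "emeasure \<pi> (UNIV \<times> C) = emeasure \<nu> C" if C: "C \<in> sets borel" for C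
  proof -
    have "(\<Sum>i\<in>I. q i j * (measure \<mu> (A i) * measure \<nu> (A j \<inter> C))) = measure \<nu> (A j \<inter> C)"
      if j: "j \<in> I" for j
    proof (cases "measure \<nu> (A j) = 0")
      case True
      have "measure \<nu> (A j \<inter> C) \<le> measure \<nu> (A j)"
        using j by (intro \<nu>.finite_measure_mono) auto
      then show ?thesis using True by (simp add: measure_le_0_iff)
    next
      case False
      have "(\<Sum>i\<in>I. q i j * (measure \<mu> (A i) * measure \<nu> (A j \<inter> C)))
          = (\<Sum>i\<in>I. measure \<nu> (A j \<inter> C) / measure \<nu> (A j) * w i j)"
        using False by (intro sum.cong refl) (simp add: qw[OF _ j, symmetric])
      also have "\<dots> = measure \<nu> (A j \<inter> C)"
        unfolding sum_distrib_left[symmetric] col[OF j] using False by simp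
      finally show ?thesis .
    qed
    moreover have "(\<Sum>i\<in>I. \<Sum>j\<in>I. q i j * (measure \<mu> (A i) * measure \<nu> (A j \<inter> C)))
      = (\<Sum>j\<in>I. \<Sum>i\<in>I. q i j * (measure \<mu> (A i) * measure \<nu> (A j \<inter> C)))" by (rule sum.swap)
    ultimately show ?thesis using rect[OF _ C, of UNIV] split[OF \<nu> cover(2) C]
      by (simp add: \<nu>.emeasure_eq_measure)
  qed
  show ?thesis
  proof
    show "\<pi> \<in> couplings \<mu> \<nu>"
      unfolding couplings_def
    proof (intro CollectI conjI)
      show "prob_space \<pi>"
      proof
        show "emeasure \<pi> (space \<pi>) = 1"
          using fst[of UNIV] \<mu>.emeasure_space_1 sp space_pi by simp
      qed
      show "sets \<pi> = sets (borel \<Otimes>\<^sub>M borel)" by fact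
      have meas: "fst \<in> measurable \<pi> borel" "snd \<in> measurable \<pi> borel"
        unfolding measurable_cong_sets[OF sets_pi refl] by simp_all
      show "distr \<pi> borel fst = \<mu>"
      proof (rule measure_eqI)
        fix B assume "B \<in> sets (distr \<pi> borel fst)"
        then have B: "B \<in> sets borel" by simp
        have "fst -` B \<inter> space \<pi> = B \<times> UNIV" by (auto simp: space_pi)
        then show "emeasure (distr \<pi> borel fst) B = emeasure \<mu> B"
          using fst[OF B] meas B by (simp add: emeasure_distr)
      qed (simp add: \<mu>)
      show "distr \<pi> borel snd = \<nu>"
      proof (rule measure_eqI)
        fix B assume "B \<in> sets (distr \<pi> borel snd)"
        then have B: "B \<in> sets borel" by simp
        have "snd -` B \<inter> space \<pi> = UNIV \<times> B" by (auto simp: space_pi)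
        then show "emeasure (distr \<pi> borel snd) B = emeasure \<nu> B"
          using snd[OF B] meas B by (simp add: emeasure_distr)
      qed (simp add: \<nu>)
    qed
    have h': "h \<in> borel_measurable (\<mu> \<Otimes>\<^sub>M \<nu>)"
      using h unfolding measurable_cong_sets[OF sets_pair refl] .
    have "(\<integral>\<^sup>+ z. h z \<partial>\<pi>) = (\<integral>\<^sup>+ z. g z * h z \<partial>(\<mu> \<Otimes>\<^sub>M \<nu>))"
      unfolding \<pi>_def by (rule nn_integral_density[OF g h'])
    \<comment> \<open>On \<open>A i \<times> A j\<close> the cost \<open>h\<close> is replaced by
      its bound \<open>D i j\<close>, which leaves a step function.\<close>
    also have "\<dots> \<le> (\<integral>\<^sup>+ z. (\<Sum>i\<in>I. \<Sum>j\<in>I. ennreal (q i j * D i j) * indicator (A i \<times> A j) z) \<partial>(\<mu> \<Otimes>\<^sub>M \<nu>))"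
      unfolding g_def sum_distrib_right
      by (intro nn_integral_mono sum_mono)
         (auto split: split_indicator simp: q0 D0 D ennreal_mult intro!: mult_left_mono)
    also have "\<dots> = ennreal (\<Sum>i\<in>I. \<Sum>j\<in>I. q i j * D i j * (measure \<mu> (A i) * measure \<nu> (A j)))"
      using A \<mu> \<nu> q0 D0 by (intro nn_integral_sum_rectangles) auto
    also have "(\<Sum>i\<in>I. \<Sum>j\<in>I. q i j * D i j * (measure \<mu> (A i) * measure \<nu> (A j))) = (\<Sum>i\<in>I. \<Sum>j\<in>I. w i j * D i j)"
      by (intro sum.cong refl) (simp add: qw[symmetric] mult_ac)
    finally show "(\<integral>\<^sup>+ z. h z \<partial>\<pi>) \<le> ennreal (\<Sum>i\<in>I. \<Sum>j\<in>I. w i j * D i j)" .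
  qed
qed

subsection \<open>Dyadic cells and histograms\<close>

lemma multi_idx_eq_PiE: "(multi_idx b :: ('d::finite \<Rightarrow> nat) set) = (\<Pi>\<^sub>E l\<in>UNIV. {1..b})"
  by (auto simp: multi_idx_def PiE_def Pi_def)

lemma finite_multi_idx [simp]: "finite (multi_idx b :: ('d::finite \<Rightarrow> nat) set)"
  unfolding multi_idx_eq_PiE by (rule finite_PiE) auto

text \<open>The index can be read off the point by a floor, so disjointness and covering become
  uniqueness and existence of that floor. The shift by 1 is due to indices starting at 1.\<close>

lemma mem_cell_iff:
  assumes "0 < b"
  shows "x \<in> cell i b \<longleftrightarrow> (\<forall>l. \<lfloor>real b * x$l\<rfloor> = int (i l) - 1)"
proof -
  have "(real (i l) - 1) / real b \<le> x$l \<and> x$l < real (i l) / real b \<longleftrightarrow> \<lfloor>real b * x$l\<rfloor> = int (i l) - 1" for l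
    using assms by (auto simp: floor_eq_iff divide_le_eq less_divide_eq mult.commute)
  then show ?thesis by (simp add: cell_def)
qed

lemma disjoint_cells:
  assumes "0 < b"
  shows "disjoint_family_on (\<lambda>i. cell i b :: (real^'d) set) (multi_idx b)"
proof -
  have "i = j" if "x \<in> cell i b" "x \<in> cell j b" for x :: "real^'d" and i j :: "'d \<Rightarrow> nat"
  proof
    fix l show "i l = j l"
      using that assms by (simp add: mem_cell_iff)
  qed
  then show ?thesis by (auto simp: disjoint_family_on_def)
qed

lemma Union_cells:
  assumes "0 < b"
  shows "(\<Union>i\<in>multi_idx b. cell i b) = (unit_cube :: (real^'d) set)"
proof (intro equalityI subsetI)
  fix x :: "real^'d" assume "x \<in> (\<Union>i\<in>multi_idx b. cell i b)"
  then obtain i where i: "i \<in> multi_idx b" "x \<in> cell i b" by auto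
  have "0 \<le> x$l \<and> x$l < 1" for l
  proof
    have "1 \<le> i l" "i l \<le> b" using i by (auto simp: multi_idx_def)
    then have "0 \<le> (real (i l) - 1) / real b" "real (i l) / real b \<le> 1" using assms by auto
    then show "0 \<le> x$l" "x$l < 1"
      using i(2) unfolding cell_def mem_Collect_eq by (meson order_trans, meson less_le_trans)
  qed
  then show "x \<in> unit_cube" by (simp add: unit_cube_def)
next
  fix x :: "real^'d" assume x: "x \<in> unit_cube"
  \<comment> \<open>The floor of \<open>b * x$l\<close> lies between 0 and b - 1 on the cube; adding
    1 puts it in the index range.\<close>
  define i where "i l = nat (\<lfloor>real b * x$l\<rfloor> + 1)" for l
  have f: "0 \<le> \<lfloor>real b * x$l\<rfloor>" "\<lfloor>real b * x$l\<rfloor> < int b" for l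
    using x assms by (auto simp: unit_cube_def floor_less_iff)
  have "1 \<le> i l \<and> i l \<le> b" for l
    using f[of l] unfolding i_def by linarith
  then have "i \<in> multi_idx b" by (simp add: multi_idx_def)
  moreover have "x \<in> cell i b" using f assms by (simp add: mem_cell_iff i_def)
  ultimately show "x \<in> (\<Union>i\<in>multi_idx b. cell i b)" by auto
qed

lemma cell_borel [measurable, simp]: "(cell i b :: (real^'d) set) \<in> sets borel"
proof -
  have [measurable]: "(\<lambda>x::real^'d. x $ l) \<in> borel_measurable borel" for l
    by (intro borel_measurable_continuous_onI continuous_on_component continuous_on_id)
  show ?thesis unfolding cell_def by measurable
qed

lemma unit_cube_borel [measurable, simp]: "(unit_cube :: (real^'d) set) \<in> sets borel"
  using Union_cells[of 1, where 'd = 'd] by (metis cell_borel finite_multi_idx sets.finite_UN zero_less_one)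

text \<open>The half-open cell lies between an open and a closed box of equal volume.\<close>

lemma emeasure_lborel_cell:
  assumes "0 < b"
  shows "emeasure lborel (cell i b :: (real^'d) set) = ennreal (1 / real b ^ CARD('d))"
proof -
  define u v :: "real^'d" where "u = (\<chi> l. (real (i l) - 1) / real b)" and "v = (\<chi> l. real (i l) / real b)"
  have le: "u \<bullet> k \<le> v \<bullet> k" if "k \<in> Basis" for k
    using that by (auto simp: u_def v_def Basis_vec_def inner_axis divide_right_mono)
  have prod: "(\<Prod>k\<in>Basis. (v - u) \<bullet> k) = 1 / real b ^ CARD('d)"
  proof -
    have "(v - u) \<bullet> k = 1 / real b" if "k \<in> Basis" for k
      using that assms by (auto simp: u_def v_def Basis_vec_def inner_axis field_simps)
    then show ?thesis by (simp add: power_one_over)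
  qed
  have "box u v \<subseteq> cell i b" "cell i b \<subseteq> cbox u v"
    by (auto simp: cell_def u_def v_def mem_box_cart less_imp_le)
  then have "emeasure lborel (box u v) \<le> emeasure lborel (cell i b)"
    "emeasure lborel (cell i b) \<le> emeasure lborel (cbox u v)"
    by (auto intro!: emeasure_mono)
  moreover have "emeasure lborel (box u v) = ennreal (1 / real b ^ CARD('d))"
    "emeasure lborel (cbox u v) = ennreal (1 / real b ^ CARD('d))"
    using le prod by (simp_all add: emeasure_lborel_box emeasure_lborel_cbox)
  ultimately show ?thesis by simp
qed

section \<open>Histogram measures and their cell masses\<close>

lemma sets_histogram [simp]: "sets (histogram b w) = sets borel"
  by (simp add: histogram_def)

lemma emeasure_histogram:
  fixes w :: "('d::finite \<Rightarrow> nat) \<Rightarrow> real"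
  assumes w: "\<And>i. i \<in> multi_idx b \<Longrightarrow> 0 \<le> w i" and B: "B \<in> sets borel"
  shows "emeasure (histogram b w) B =
    (\<Sum>i\<in>multi_idx b. ennreal (real b ^ CARD('d) * w i) * emeasure lborel (cell i b \<inter> B))"
proof -
  have "emeasure (histogram b w) B =
      (\<integral>\<^sup>+y. ennreal (\<Sum>i\<in>multi_idx b. real b ^ CARD('d) * w i * indicator (cell i b) y) * indicator B y \<partial>lborel)"
    unfolding histogram_def
  proof (rule emeasure_density)
    show "(\<lambda>y. ennreal (\<Sum>i\<in>multi_idx b. real b ^ CARD('d) * w i * indicator (cell i b) y)) \<in> borel_measurable lborel"
      by measurable
    show "B \<in> sets lborel" using B by simp
  qed
  also have "\<dots> = (\<integral>\<^sup>+y. (\<Sum>i\<in>multi_idx b. ennreal (real b ^ CARD('d) * w i) * indicator (cell i b \<inter> B) y) \<partial>lborel)"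
  proof (intro nn_integral_cong)
    fix y :: "real^'d"
    have "ennreal (\<Sum>i\<in>multi_idx b. real b ^ CARD('d) * w i * indicator (cell i b) y)
        = (\<Sum>i\<in>multi_idx b. ennreal (real b ^ CARD('d) * w i * indicator (cell i b) y))"
      using w by (intro sum_ennreal[symmetric]) auto
    then show "ennreal (\<Sum>i\<in>multi_idx b. real b ^ CARD('d) * w i * indicator (cell i b) y) * indicator B y
        = (\<Sum>i\<in>multi_idx b. ennreal (real b ^ CARD('d) * w i) * indicator (cell i b \<inter> B) y)"
      by (simp only: sum_distrib_right) (intro sum.cong refl, simp split: split_indicator)
  qed
  also have "\<dots> = (\<Sum>i\<in>multi_idx b. \<integral>\<^sup>+y. ennreal (real b ^ CARD('d) * w i) * indicator (cell i b \<inter> B) y \<partial>lborel)"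
    using B by (intro nn_integral_sum) auto
  also have "\<dots> = (\<Sum>i\<in>multi_idx b. ennreal (real b ^ CARD('d) * w i) * emeasure lborel (cell i b \<inter> B))"
    using B by (intro sum.cong refl nn_integral_cmult_indicator) auto
  finally show ?thesis .
qed

text \<open>The factor b ^ d in the density cancels the volume of a cell, so cell \<open>i\<close>
  receives exactly the mass \<open>w i\<close>.\<close>

lemma
  fixes w :: "('d::finite \<Rightarrow> nat) \<Rightarrow> real"
  assumes b: "0 < b" and w: "\<And>i. i \<in> multi_idx b \<Longrightarrow> 0 \<le> w i" and w1: "sum w (multi_idx b) = 1"
  shows prob_on_cube_histogram: "prob_on_cube (histogram b w)"
    and measure_histogram_cell: "\<And>j. j \<in> multi_idx b \<Longrightarrow> measure (histogram b w) (cell j b) = w j"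
proof -
  have vol: "ennreal (real b ^ CARD('d) * w i) * emeasure lborel (cell i b :: (real^'d) set) = ennreal (w i)"
    if "i \<in> multi_idx b" for i
    using b w[OF that] by (simp add: emeasure_lborel_cell ennreal_mult[symmetric])
  have sp: "space (histogram b w) = UNIV" by (simp add: histogram_def)
  have "emeasure (histogram b w) UNIV = (\<Sum>i\<in>multi_idx b. ennreal (w i))"
    using emeasure_histogram[of b w UNIV, OF w] vol by simp
  also have "\<dots> = 1" using w w1 by (subst sum_ennreal) auto
  finally have "prob_space (histogram b w)" by (intro prob_spaceI) (simp add: sp)
  moreover have "emeasure (histogram b w) (UNIV - unit_cube) = 0"
  proof -
    have "cell i b \<inter> (UNIV - unit_cube) = {}" if "i \<in> multi_idx b" for i :: "'d \<Rightarrow> nat"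
      using Union_cells[OF b, where 'd='d] that by auto
    moreover have "(UNIV - unit_cube :: (real^'d) set) \<in> sets borel" by (intro sets.Diff) auto
    ultimately show ?thesis using emeasure_histogram[of b w "UNIV - unit_cube", OF w] by simp
  qed
  ultimately show "prob_on_cube (histogram b w)" by (simp add: prob_on_cube_def)
  show "measure (histogram b w) (cell j b) = w j" if j: "j \<in> multi_idx b" for j
  proof -
    have "emeasure (histogram b w) (cell j b)
        = (\<Sum>i\<in>multi_idx b. if i = j then ennreal (w j) else 0)"
    proof (subst emeasure_histogram[of b w "cell j b", OF w], assumption, rule cell_borel, intro sum.cong refl)
      fix i :: "'d \<Rightarrow> nat" assume i: "i \<in> multi_idx b"
      have "(cell i b \<inter> cell j b :: (real^'d) set) = {}" if "i \<noteq> j"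
        using disjoint_cells[OF b, where 'd = 'd] i j that by (auto simp: disjoint_family_on_def)
      then show "ennreal (real b ^ CARD('d) * w i) * emeasure lborel (cell i b \<inter> cell j b :: (real^'d) set)
          = (if i = j then ennreal (w j) else 0)"
        using vol[OF j] by auto
    qed
    then show ?thesis using j w[OF j] by (simp add: measure_def)
  qed
qed

section \<open>The dyadic tree of cells\<close>

text \<open>\<open>ancestor l i\<close> is the index (counted from \<open>0\<close>) of the dyadic cell containing the
  cell \<open>i\<close> and being \<open>2 ^ l\<close> times as wide.\<close>

definition ancestor :: "nat \<Rightarrow> ('d \<Rightarrow> nat) \<Rightarrow> 'd \<Rightarrow> nat"
  where "ancestor l i = (\<lambda>k. (i k - 1) div 2 ^ l)"

text \<open>Dividing by 2 ^ (l+1) is dividing by 2 ^ l and then by 2, so an ancestor determines all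
  higher ones. This is the nestedness required by \<open>tree_coupling\<close>.\<close>

lemma ancestor_Suc:
  fixes i j :: "'d \<Rightarrow> nat"
  shows "ancestor l i = ancestor l j \<Longrightarrow> ancestor (Suc l) i = ancestor (Suc l) j"
proof -
  have "ancestor (Suc l) h = (\<lambda>k. ancestor l h k div 2)" for h :: "'d \<Rightarrow> nat"
    unfolding ancestor_def power_Suc2 div_mult2_eq ..
  then show "ancestor l i = ancestor l j \<Longrightarrow> ancestor (Suc l) i = ancestor (Suc l) j" by simp
qed

lemma ancestor_top:
  assumes "i \<in> multi_idx (2 ^ K)"
  shows "ancestor K i = (\<lambda>_. 0)"
proof
  fix k
  have "1 \<le> i k" "i k \<le> 2 ^ K" using assms by (auto simp: multi_idx_def)
  then have "i k - 1 < 2 ^ K" by linarith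
  then show "ancestor K i k = 0" by (simp add: ancestor_def)
qed

text \<open>Each of the d coordinates of an ancestor at height \<open>l\<close> is below 2 ^ (K -
  l). This count is the number of summands in the later Cauchy-Schwarz estimate.\<close>

lemma card_ancestor_le:
  assumes "l \<le> K"
  shows "card (ancestor l ` (multi_idx (2 ^ K) :: ('d::finite \<Rightarrow> nat) set)) \<le> 2 ^ ((K - l) * CARD('d))"
proof -
  have "ancestor l i k < 2 ^ (K - l)" if "i \<in> multi_idx (2 ^ K)" for i :: "'d \<Rightarrow> nat" and k
  proof -
    have "1 \<le> i k" "i k \<le> 2 ^ K" using that by (auto simp: multi_idx_def)
    then have "i k - 1 < 2 ^ (K - l) * 2 ^ l" using assms by (simp flip: power_add)
    then show ?thesis by (simp add: ancestor_def less_mult_imp_div_less)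
  qed
  then have "ancestor l ` (multi_idx (2 ^ K) :: ('d \<Rightarrow> nat) set) \<subseteq> (\<Pi>\<^sub>E k\<in>UNIV. {..<2 ^ (K - l)})"
    by auto
  then have "card (ancestor l ` (multi_idx (2 ^ K) :: ('d \<Rightarrow> nat) set))
      \<le> card (\<Pi>\<^sub>E k\<in>(UNIV::'d set). {..<(2::nat) ^ (K - l)})"
    by (intro card_mono finite_PiE) auto
  also have "\<dots> = 2 ^ ((K - l) * CARD('d))" by (simp add: card_PiE power_mult)
  finally show ?thesis .
qed

text \<open>In each coordinate both points lie in the interval of the common ancestor, whose length
  is the bound.\<close>

lemma ancestor_dist_le:
  assumes ij: "i \<in> multi_idx (2 ^ K)" "j \<in> multi_idx (2 ^ K)" and anc: "ancestor l i = ancestor l j"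
    and x: "x \<in> cell i (2 ^ K)" and y: "y \<in> cell j (2 ^ K)"
  shows "\<bar>x$k - y$k\<bar> \<le> 2 ^ l / 2 ^ K"
proof -
  define m where "m = (i k - 1) div 2 ^ l"
  have bound: "real m * 2 ^ l / 2 ^ K \<le> z$k \<and> z$k \<le> (real m + 1) * 2 ^ l / 2 ^ K"
    if "h \<in> multi_idx (2 ^ K)" "(h k - 1) div 2 ^ l = m" "z \<in> cell h (2 ^ K)" for h and z :: "real^'a"
  proof -
    have h1: "1 \<le> h k" using that by (simp add: multi_idx_def)
    have "m * 2 ^ l \<le> h k - 1" "h k - 1 < (m + 1) * 2 ^ l"
      using dividend_less_div_times[of "2 ^ l" "h k - 1", unfolded that(2)]
        div_times_less_eq_dividend[of "h k - 1" "2 ^ l", unfolded that(2)]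
      by simp_all
    then have "real (m * 2 ^ l) \<le> real (h k - 1)" "real (h k) \<le> real ((m + 1) * 2 ^ l)"
      unfolding of_nat_le_iff by auto
    then have "real m * 2 ^ l \<le> real (h k) - 1" "real (h k) \<le> (real m + 1) * 2 ^ l"
      using h1 by (auto simp: of_nat_diff distrib_right)
    then have "real m * 2 ^ l / 2 ^ K \<le> (real (h k) - 1) / 2 ^ K" "real (h k) / 2 ^ K \<le> (real m + 1) * 2 ^ l / 2 ^ K"
      by (auto intro: divide_right_mono)
    moreover have "(real (h k) - 1) / 2 ^ K \<le> z$k" "z$k < real (h k) / 2 ^ K"
      using that(3) by (auto simp: cell_def)
    ultimately show ?thesis by linarith
  qed
  have "(j k - 1) div 2 ^ l = m" using anc by (auto simp: ancestor_def m_def dest: fun_cong[of _ _ k])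
  then have "real m * 2 ^ l / 2 ^ K \<le> y$k" "y$k \<le> (real m + 1) * 2 ^ l / 2 ^ K"
    "real m * 2 ^ l / 2 ^ K \<le> x$k" "x$k \<le> (real m + 1) * 2 ^ l / 2 ^ K"
    using bound[OF ij(2) _ y] bound[OF ij(1) _ x] by (auto simp: m_def)
  moreover have "(real m + 1) * 2 ^ l / 2 ^ K = real m * 2 ^ l / 2 ^ K + 2 ^ l / 2 ^ K"
    by (simp add: field_simps)
  ultimately show ?thesis by linarith
qed

section \<open>The tree bound for the Wasserstein distance\<close>

lemma AE_unit_cube: "prob_on_cube \<mu> \<Longrightarrow> AE x in \<mu>. x \<in> unit_cube"
  by (rule AE_I[of _ _ "UNIV - unit_cube"]) (auto simp: prob_on_cube_def)

lemma prob_on_cube_measure_cells: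
  fixes \<mu> :: "(real^'d) measure"
  assumes "prob_on_cube \<mu>" "0 < b"
  shows "(\<Sum>i\<in>multi_idx b. measure \<mu> (cell i b)) = 1"
proof -
  interpret prob_space \<mu> using assms by (simp add: prob_on_cube_def)
  have s: "sets \<mu> = sets borel" using assms by (simp add: prob_on_cube_def)
  have "(\<Sum>i\<in>multi_idx b. measure \<mu> (cell i b)) = measure \<mu> (\<Union>i\<in>multi_idx b. cell i b)"
    using disjoint_cells[OF assms(2)] by (intro finite_measure_finite_Union[symmetric]) (auto simp: s)
  also have "\<dots> = 1"
    unfolding Union_cells[OF assms(2)] using AE_unit_cube[OF assms(1)] by (subst prob_eq_1) (auto simp: s)
  finally show ?thesis .
qed

text \<open>\<open>tree_coupling\<close> is applied to the cell masses of the two measures, and the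
  resulting matrix is lifted by \<open>coupling_of_matrix\<close>. The factor d powr v comes from
  \<open>pdist_le\<close>.\<close>

lemma wasserstein_histogram_le:
  fixes \<mu> :: "(real^'d) measure" and w :: "('d \<Rightarrow> nat) \<Rightarrow> real" and K :: nat
  defines "I \<equiv> multi_idx (2 ^ K)"
  assumes p: "1 \<le> p" and v: "1 \<le> v" and \<mu>: "prob_on_cube \<mu>"
    and w: "\<And>i. i \<in> I \<Longrightarrow> 0 \<le> w i" and w1: "sum w I = 1"
  shows "wasserstein p v \<mu> (histogram (2 ^ K) w) \<le>
    (real CARD('d) powr v * ((1 / 2 ^ K) powr v + (\<Sum>l<K. (2 ^ Suc l / 2 ^ K) powr v *
      ((\<Sum>q\<in>ancestor l ` I. \<bar>\<Sum>i\<in>{i\<in>I. ancestor l i = q}. measure \<mu> (cell i (2 ^ K)) - w i\<bar>) / 2))))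
    powr (1/v)" (is "_ \<le> ?R powr (1/v)")
proof -
  let ?c = "\<lambda>i. cell i (2 ^ K) :: (real^'d) set"
  define e where "e l = (real CARD('d) * (2 ^ l / 2 ^ K)) powr v" for l :: nat
  \<comment> \<open>The cost of the lowest common ancestor, an ultrametric-like bound. It is at most
    \<open>e l\<close> whenever the ancestors at height \<open>l\<close> agree, because
    \<open>e\<close> increases, and it still dominates the true cost between the two cells.\<close>
  define D where "D i j = e (LEAST l. ancestor l i = ancestor l j)" for i j :: "'d \<Rightarrow> nat"
  have I: "finite I" by (simp add: I_def)
  have e_mono: "e l \<le> e m" if "l \<le> m" for l m
    unfolding e_def using that v by (intro powr_mono2 mult_left_mono divide_right_mono power_increasing) auto
  have top: "ancestor K i = ancestor K j" if "i \<in> I" "j \<in> I" for i j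
    using that by (simp add: I_def ancestor_top)
  have D_le: "D i j \<le> e l" if "ancestor l i = ancestor l j" for i j l
    unfolding D_def using that by (intro e_mono Least_le)
  note hist = prob_on_cube_histogram[of "2 ^ K" w] measure_histogram_cell[of "2 ^ K" w]
  have h: "prob_on_cube (histogram (2 ^ K) w)" using hist(1) w w1 by (simp add: I_def)
  have hc: "measure (histogram (2 ^ K) w) (?c j) = w j" if "j \<in> I" for j
    using hist(2) w w1 that by (simp add: I_def)
  have sum1: "(\<Sum>i\<in>I. measure \<mu> (?c i)) = 1"
    unfolding I_def by (rule prob_on_cube_measure_cells[OF \<mu>]) simp
  have sum_eq: "(\<Sum>i\<in>I. measure \<mu> (?c i)) = sum w I" by (simp add: sum1 w1)
  have e0: "0 \<le> e l" for l by (simp add: e_def)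
  have "\<exists>W. (\<forall>i\<in>I. \<forall>j\<in>I. 0 \<le> W i j) \<and> (\<forall>i\<in>I. (\<Sum>j\<in>I. W i j) = measure \<mu> (?c i)) \<and> (\<forall>j\<in>I. (\<Sum>i\<in>I. W i j) = w j)
    \<and> (\<Sum>i\<in>I. \<Sum>j\<in>I. W i j * D i j) \<le> e 0 * (\<Sum>i\<in>I. measure \<mu> (?c i)) +
        (\<Sum>l<K. e (Suc l) * ((\<Sum>q\<in>ancestor l ` I. \<bar>\<Sum>i\<in>{i\<in>I. ancestor l i = q}. measure \<mu> (?c i) - w i\<bar>) / 2))"
    by (rule tree_coupling[of I "\<lambda>i. measure \<mu> (?c i)" w e ancestor D K,
          OF I measure_nonneg w e0 ancestor_Suc D_le top sum_eq])
  then obtain W where W: "\<forall>i\<in>I. \<forall>j\<in>I. 0 \<le> W i j"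
    "\<forall>i\<in>I. (\<Sum>j\<in>I. W i j) = measure \<mu> (?c i)" "\<forall>j\<in>I. (\<Sum>i\<in>I. W i j) = w j"
    "(\<Sum>i\<in>I. \<Sum>j\<in>I. W i j * D i j) \<le> e 0 * (\<Sum>i\<in>I. measure \<mu> (?c i)) +
        (\<Sum>l<K. e (Suc l) * ((\<Sum>q\<in>ancestor l ` I. \<bar>\<Sum>i\<in>{i\<in>I. ancestor l i = q}. measure \<mu> (?c i) - w i\<bar>) / 2))"
    by blast
  have e_eq: "e l = real CARD('d) powr v * (2 ^ l / 2 ^ K) powr v" for l
    unfolding e_def by (rule powr_mult)
  have cost: "(\<Sum>i\<in>I. \<Sum>j\<in>I. W i j * D i j) \<le> ?R"
    using W(4) unfolding sum1 e_eq
    by (simp only: distrib_left sum_distrib_left mult.assoc mult_1_right power_0)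
  have cover: "AE x in \<rho>. x \<in> (\<Union>i\<in>I. ?c i)" if "prob_on_cube \<rho>" for \<rho>
    using AE_unit_cube[OF that] Union_cells[of "2 ^ K", where 'd = 'd] by (simp add: I_def)
  have hD: "ennreal (pdist p (fst (x, y)) (snd (x, y)) powr v) \<le> ennreal (D i j)"
    if "i \<in> I" "j \<in> I" "x \<in> ?c i" "y \<in> ?c j" for i j and x y :: "real^'d"
  proof -
    \<comment> \<open>The minimum is attained since all indices in \<open>I\<close> share their
      ancestor at height \<open>K\<close>.\<close>
    have "ancestor (LEAST l. ancestor l i = ancestor l j) i = ancestor (LEAST l. ancestor l i = ancestor l j) j"
      using top[OF that(1,2)] by (rule LeastI)
    then have "pdist p x y \<le> real CARD('d) * (2 ^ (LEAST l. ancestor l i = ancestor l j) / 2 ^ K)"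
      using that p by (intro pdist_le ancestor_dist_le[of i K j]) (auto simp: I_def)
    then show ?thesis unfolding D_def e_def using v
      by (intro ennreal_leI) (auto intro!: powr_mono2 simp: pdist_def)
  qed
  have \<mu>': "prob_space \<mu>" "sets \<mu> = sets borel" and h': "prob_space (histogram (2 ^ K) w)"
    using \<mu> h by (auto simp: prob_on_cube_def)
  have disj: "disjoint_family_on ?c I" unfolding I_def by (rule disjoint_cells) simp
  have hm: "(\<lambda>z. ennreal (pdist p (fst z) (snd z) powr v)) \<in> borel_measurable (borel \<Otimes>\<^sub>M borel)"
    by measurable
  have col: "(\<Sum>i\<in>I. W i j) = measure (histogram (2 ^ K) w) (?c j)" if "j \<in> I" for j
    using W(3) hc that by simp
  have D0: "0 \<le> D i j" for i j by (simp add: D_def e0)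
  have W0: "0 \<le> W i j" if "i \<in> I" "j \<in> I" for i j using W(1) that by blast
  have row: "(\<Sum>j\<in>I. W i j) = measure \<mu> (?c i)" if "i \<in> I" for i using W(2) that by blast
  have "\<exists>\<pi>\<in>couplings \<mu> (histogram (2 ^ K) w). (\<integral>\<^sup>+ z. ennreal (pdist p (fst z) (snd z) powr v) \<partial>\<pi>)
      \<le> ennreal (\<Sum>i\<in>I. \<Sum>j\<in>I. W i j * D i j)"
    by (rule coupling_of_matrix[of \<mu> "histogram (2 ^ K) w" I ?c W "\<lambda>z. ennreal (pdist p (fst z) (snd z) powr v)" D,
          OF \<mu>' h' sets_histogram I disj cell_borel cover[OF \<mu>] cover[OF h] W0 row col hm hD D0])
  then obtain \<pi> where \<pi>: "\<pi> \<in> couplings \<mu> (histogram (2 ^ K) w)"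
    "(\<integral>\<^sup>+ z. ennreal (pdist p (fst z) (snd z) powr v) \<partial>\<pi>) \<le> ennreal (\<Sum>i\<in>I. \<Sum>j\<in>I. W i j * D i j)"
    by blast
  have "0 \<le> ?R" by (auto intro!: mult_nonneg_nonneg add_nonneg_nonneg sum_nonneg)
  moreover have "(\<integral>\<^sup>+ z. ennreal (pdist p (fst z) (snd z) powr v) \<partial>\<pi>) \<le> ennreal ?R"
    using \<pi>(2) cost by (meson ennreal_leI order_trans)
  ultimately show ?thesis using \<pi>(1) v by (intro wasserstein_le_of_coupling)
qed

subsection \<open>The expected error\<close>

text \<open>Jensen's inequality for the concave \<open>x powr (1/v)\<close>, via its tangent at \<open>c\<close>; only an upper
  bound of the root need be integrated, so the integrand may be non-measurable.\<close>

lemma (in prob_space) nn_integral_root_le: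
  fixes G :: "'a \<Rightarrow> real"
  assumes G: "integrable M G" "\<And>\<omega>. 0 \<le> G \<omega>" and c: "expectation G \<le> c" "0 < c" and v: "1 \<le> v"
    and W: "AE \<omega> in M. W \<omega> \<le> G \<omega> powr (1/v)"
  shows "(\<integral>\<^sup>+\<omega>. ennreal (W \<omega>) \<partial>M) \<le> ennreal (c powr (1/v))"
proof -
  define A where "A \<omega> = c powr (1/v) * (1/v * (G \<omega> / c) + (1 - 1/v))" for \<omega>
  have A: "G \<omega> powr (1/v) \<le> A \<omega>" for \<omega>
  proof -
    have "G \<omega> powr (1/v) = c powr (1/v) * (G \<omega> / c) powr (1/v)"
      using c(2) by (simp add: powr_mult[symmetric])
    \<comment> \<open>Young's inequality with weights 1/v and 1 - 1/v and second argument 1 is the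
      tangent bound at 1. It needs a positive first argument, hence the separate case of
      \<open>G\<close> vanishing.\<close>
    also have "(G \<omega> / c) powr (1/v) \<le> 1/v * (G \<omega> / c) + (1 - 1/v)"
      using Youngs_inequality_0[of "1/v" "1 - 1/v" "G \<omega> / c" 1] v c(2) G(2)[of \<omega>]
      by (cases "G \<omega> = 0") auto
    finally show ?thesis using A_def by (simp add: mult_left_mono)
  qed
  have A0: "0 \<le> A \<omega>" for \<omega> using A[of \<omega>] powr_ge_zero[of "G \<omega>" "1/v"] by linarith
  have iA: "integrable M A" unfolding A_def using G(1) by simp
  have "(\<integral>\<^sup>+\<omega>. ennreal (W \<omega>) \<partial>M) \<le> (\<integral>\<^sup>+\<omega>. ennreal (A \<omega>) \<partial>M)"
  proof (rule nn_integral_mono_AE)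
    show "AE \<omega> in M. ennreal (W \<omega>) \<le> ennreal (A \<omega>)"
      using W
    proof eventually_elim
      fix \<omega> assume "W \<omega> \<le> G \<omega> powr (1/v)"
      then show "ennreal (W \<omega>) \<le> ennreal (A \<omega>)" using A[of \<omega>] by (intro ennreal_leI) linarith
    qed
  qed
  also have "\<dots> = ennreal (expectation A)" using iA A0 by (intro nn_integral_eq_integral) auto
  also have "expectation A = c powr (1/v) * (1/v * (expectation G / c) + (1 - 1/v))"
    unfolding A_def using G(1) by (simp add: prob_space)
  also have "\<dots> \<le> c powr (1/v) * (1/v * 1 + (1 - 1/v))"
    using c v by (intro mult_left_mono add_right_mono) auto
  finally show ?thesis by (simp add: ennreal_leI)
qed

text \<open>Independence kills the cross terms, and each diagonal term is q (1 - q) with q the mass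
  of \<open>B\<close>. Keeping q instead of a uniform constant matters: summed over the disjoint
  classes of one level, these bounds give only 1/n.\<close>

lemma (in prob_space) empirical_second_moment:
  fixes Y :: "nat \<Rightarrow> 'a \<Rightarrow> 'b"
  assumes Y: "\<And>t. t \<ge> 1 \<Longrightarrow> Y t \<in> measurable M N" and indep: "indep_vars (\<lambda>_. N) Y {1..}"
    and dist: "\<And>t. t \<ge> 1 \<Longrightarrow> distr M N (Y t) = P" and B: "B \<in> sets N" and n: "1 \<le> n"
  defines "X \<equiv> \<lambda>\<omega>. real (card {t\<in>{1..n}. Y t \<omega> \<in> B}) / real n - measure P B"
  shows "integrable M (\<lambda>\<omega>. (X \<omega>)\<^sup>2)" and "expectation (\<lambda>\<omega>. (X \<omega>)\<^sup>2) \<le> measure P B / real n"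
proof -
  define q where "q = measure P B"
  define Z where "Z t \<omega> = indicator B (Y t \<omega>) - q" for t \<omega>
  interpret P: prob_space P
    using prob_space_distr[OF Y[of 1]] dist[of 1] by simp
  have q: "0 \<le> q" "q \<le> 1" by (auto simp: q_def)
  have Zm[measurable]: "Z t \<in> borel_measurable M" if "t \<ge> 1" for t
    unfolding Z_def using Y[OF that] B by measurable
  have Zb: "\<bar>Z t \<omega>\<bar> \<le> 1" for t \<omega> using q by (auto simp: Z_def split: split_indicator)
  have iZ: "integrable M (Z t)" if "t \<ge> 1" for t
    using Zm[OF that] Zb by (intro integrable_const_bound[of _ 1]) auto
  have iZZ: "integrable M (\<lambda>\<omega>. Z s \<omega> * Z t \<omega>)" if "s \<ge> 1" "t \<ge> 1" for s t
  proof (rule integrable_const_bound[of _ 1])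
    show "AE \<omega> in M. norm (Z s \<omega> * Z t \<omega>) \<le> 1"
      using mult_mono[OF Zb Zb] by (simp add: abs_mult)
  qed (use Zm that in measurable)
  have EI: "expectation (\<lambda>\<omega>. indicator B (Y t \<omega>)) = q" if "t \<ge> 1" for t
  proof -
    have "q = measure M (Y t -` B \<inter> space M)"
      using dist[OF that] measure_distr[OF Y[OF that] B] by (simp add: q_def)
    also have "\<dots> = expectation (indicator (Y t -` B \<inter> space M))"
      using measurable_sets[OF Y[OF that] B] by simp
    also have "\<dots> = expectation (\<lambda>\<omega>. indicator B (Y t \<omega>))"
      by (intro Bochner_Integration.integral_cong) (auto split: split_indicator)
    finally show ?thesis by simp
  qed
  have iI: "integrable M (\<lambda>\<omega>. indicator B (Y t \<omega>) :: real)" if "t \<ge> 1" for t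
    using iZ[OF that] Bochner_Integration.integrable_add[OF iZ[OF that] integrable_const[of q]]
    by (simp add: Z_def)
  have EZ: "expectation (Z t) = 0" if "t \<ge> 1" for t
    unfolding Z_def using iI[OF that] EI[OF that] by (simp add: prob_space)
  have cross: "expectation (\<lambda>\<omega>. Z s \<omega> * Z t \<omega>) = 0" if "s \<ge> 1" "t \<ge> 1" "s \<noteq> t" for s t
  proof -
    have "(\<lambda>x. indicator B x - q) \<in> borel_measurable N" using B by simp
    then have "indep_vars (\<lambda>_. borel) (\<lambda>t \<omega>. Z t \<omega>) {1..}"
      unfolding Z_def by (rule indep_vars_compose2[OF indep])
    then have "indep_vars (\<lambda>_. borel) Z {s, t}" by (rule indep_vars_subset) (use that in auto)
    then have "expectation (\<lambda>\<omega>. \<Prod>i\<in>{s, t}. Z i \<omega>) = (\<Prod>i\<in>{s, t}. expectation (Z i))"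
      using iZ that by (intro indep_vars_lebesgue_integral) auto
    then show ?thesis using that EZ by simp
  qed
  have sq: "expectation (\<lambda>\<omega>. Z t \<omega> * Z t \<omega>) \<le> q" if "t \<ge> 1" for t
  proof -
    \<comment> \<open>The indicator equals its own square, so the square is affine in it.\<close>
    have "Z t \<omega> * Z t \<omega> = (1 - 2 * q) * indicator B (Y t \<omega>) + q\<^sup>2" for \<omega>
      by (auto simp: Z_def power2_eq_square algebra_simps split: split_indicator)
    then have "expectation (\<lambda>\<omega>. Z t \<omega> * Z t \<omega>) = (1 - 2 * q) * q + q\<^sup>2"
      using iI[OF that] EI[OF that] by (simp add: prob_space)
    also have "\<dots> \<le> q" using q by (simp add: power2_eq_square algebra_simps)
    finally show ?thesis .
  qed
  have X: "(X \<omega>)\<^sup>2 = (\<Sum>s\<in>{1..n}. \<Sum>t\<in>{1..n}. Z s \<omega> * Z t \<omega>) / (real n)\<^sup>2" for \<omega>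
  proof -
    have "real (card {t\<in>{1..n}. Y t \<omega> \<in> B}) = (\<Sum>t\<in>{1..n}. indicator B (Y t \<omega>))"
      by (simp add: indicator_def of_bool_def sum.If_cases Int_def)
    then have "X \<omega> = (\<Sum>t\<in>{1..n}. Z t \<omega>) / real n"
      using n by (simp add: X_def Z_def sum_subtractf q_def field_simps)
    then show ?thesis by (simp add: power_divide power2_eq_square sum_product)
  qed
  show "integrable M (\<lambda>\<omega>. (X \<omega>)\<^sup>2)" 
    unfolding X by (intro integrable_divide Bochner_Integration.integrable_sum iZZ) auto
  have "expectation (\<lambda>\<omega>. (X \<omega>)\<^sup>2) = (\<Sum>s\<in>{1..n}. \<Sum>t\<in>{1..n}. expectation (\<lambda>\<omega>. Z s \<omega> * Z t \<omega>)) / (real n)\<^sup>2"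
  proof -
    have "expectation (\<lambda>\<omega>. \<Sum>s\<in>{1..n}. \<Sum>t\<in>{1..n}. Z s \<omega> * Z t \<omega>)
        = (\<Sum>s\<in>{1..n}. expectation (\<lambda>\<omega>. \<Sum>t\<in>{1..n}. Z s \<omega> * Z t \<omega>))"
      by (intro Bochner_Integration.integral_sum Bochner_Integration.integrable_sum iZZ) auto
    also have "\<dots> = (\<Sum>s\<in>{1..n}. \<Sum>t\<in>{1..n}. expectation (\<lambda>\<omega>. Z s \<omega> * Z t \<omega>))"
      by (intro sum.cong refl Bochner_Integration.integral_sum iZZ) auto
    finally show ?thesis unfolding X integral_divide_zero by simp
  qed
  also have "(\<Sum>s\<in>{1..n}. \<Sum>t\<in>{1..n}. expectation (\<lambda>\<omega>. Z s \<omega> * Z t \<omega>))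
      = (\<Sum>s\<in>{1..n}. expectation (\<lambda>\<omega>. Z s \<omega> * Z s \<omega>))"
  proof (rule sum.cong[OF refl])
    fix s assume s: "s \<in> {1..n}"
    have "(\<Sum>t\<in>{1..n}. expectation (\<lambda>\<omega>. Z s \<omega> * Z t \<omega>))
        = (\<Sum>t\<in>{1..n}. if t = s then expectation (\<lambda>\<omega>. Z s \<omega> * Z s \<omega>) else 0)"
      using s cross by (intro sum.cong) auto
    then show "(\<Sum>t\<in>{1..n}. expectation (\<lambda>\<omega>. Z s \<omega> * Z t \<omega>)) = expectation (\<lambda>\<omega>. Z s \<omega> * Z s \<omega>)"
      using s by simp
  qed
  also have "\<dots> / (real n)\<^sup>2 \<le> (\<Sum>s\<in>{1..n}. q) / (real n)\<^sup>2"
    using sq by (intro divide_right_mono sum_mono) auto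
  also have "\<dots> = q / real n" using n by (simp add: power2_eq_square)
  finally show "expectation (\<lambda>\<omega>. (X \<omega>)\<^sup>2) \<le> measure P B / real n" by (simp add: q_def)
qed

text \<open>For T > 0 the posterior mean mixes the frequencies N/n and the prior mean with weights n
  / (T + n) and T / (T + n), so its l1 distance from N/n is at most 2 T / (T + n). Merging cells
  into classes does not increase an l1 distance.\<close>

lemma posterior_mean_diff:
  fixes a \<alpha> N :: "'i \<Rightarrow> real" and f :: "'i \<Rightarrow> 'q"
  assumes I: "finite I" and \<alpha>: "\<And>i. i \<in> I \<Longrightarrow> 0 \<le> \<alpha> i" and N: "\<And>i. i \<in> I \<Longrightarrow> 0 \<le> N i"
    and n: "sum N I = n" "0 < n" and T: "sum \<alpha> I = T"
  shows "(\<Sum>q\<in>f ` I. \<bar>\<Sum>i\<in>{i\<in>I. f i = q}. a i - (\<alpha> i + N i) / (T + n)\<bar>)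
    \<le> (\<Sum>q\<in>f ` I. \<bar>(\<Sum>i\<in>{i\<in>I. f i = q}. N i) / n - (\<Sum>i\<in>{i\<in>I. f i = q}. a i)\<bar>) + 2 * T / n"
proof -
  have T0: "0 \<le> T" using \<alpha> T by (auto intro: sum_nonneg)
  have "\<bar>N i / n - (\<alpha> i + N i) / (T + n)\<bar> \<le> (N i * T + \<alpha> i * n) / (n * (T + n))" if "i \<in> I" for i
  proof -
    have "N i / n - (\<alpha> i + N i) / (T + n) = (N i * T - \<alpha> i * n) / (n * (T + n))"
      using n T0 by (simp add: field_simps)
    moreover have "\<bar>N i * T - \<alpha> i * n\<bar> \<le> N i * T + \<alpha> i * n"
      using N[OF that] \<alpha>[OF that] n T0 by (simp add: abs_le_iff)
    ultimately show ?thesis using n T0 by (simp add: abs_mult divide_right_mono)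
  qed
  then have "(\<Sum>i\<in>I. \<bar>N i / n - (\<alpha> i + N i) / (T + n)\<bar>) \<le> (\<Sum>i\<in>I. (N i * T + \<alpha> i * n) / (n * (T + n)))"
    by (rule sum_mono)
  also have "\<dots> = (n * T + T * n) / (n * (T + n))"
    by (simp add: sum_divide_distrib[symmetric] sum.distrib sum_distrib_right[symmetric] n T)
  also have "n * T + T * n = n * (2 * T)" by simp
  also have "n * (2 * T) / (n * (T + n)) = 2 * T / (T + n)" using n by simp
  also have "\<dots> \<le> 2 * T / n" using n T0 by (intro divide_left_mono) auto
  finally have prior: "(\<Sum>i\<in>I. \<bar>N i / n - (\<alpha> i + N i) / (T + n)\<bar>) \<le> 2 * T / n" .
  have "\<bar>\<Sum>i\<in>Q. a i - (\<alpha> i + N i) / (T + n)\<bar>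
      \<le> \<bar>(\<Sum>i\<in>Q. N i) / n - (\<Sum>i\<in>Q. a i)\<bar> + (\<Sum>i\<in>Q. \<bar>N i / n - (\<alpha> i + N i) / (T + n)\<bar>)" for Q
  proof -
    have "(\<Sum>i\<in>Q. a i - (\<alpha> i + N i) / (T + n))
        = - ((\<Sum>i\<in>Q. N i) / n - (\<Sum>i\<in>Q. a i)) + (\<Sum>i\<in>Q. N i / n - (\<alpha> i + N i) / (T + n))"
      by (simp add: sum_subtractf sum_divide_distrib)
    then show ?thesis
      using sum_abs[of "\<lambda>i. N i / n - (\<alpha> i + N i) / (T + n)" Q] by linarith
  qed
  then have "(\<Sum>q\<in>f ` I. \<bar>\<Sum>i\<in>{i\<in>I. f i = q}. a i - (\<alpha> i + N i) / (T + n)\<bar>)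
    \<le> (\<Sum>q\<in>f ` I. \<bar>(\<Sum>i\<in>{i\<in>I. f i = q}. N i) / n - (\<Sum>i\<in>{i\<in>I. f i = q}. a i)\<bar>
        + (\<Sum>i\<in>{i\<in>I. f i = q}. \<bar>N i / n - (\<alpha> i + N i) / (T + n)\<bar>))"
    by (rule sum_mono)
  also have "\<dots> = (\<Sum>q\<in>f ` I. \<bar>(\<Sum>i\<in>{i\<in>I. f i = q}. N i) / n - (\<Sum>i\<in>{i\<in>I. f i = q}. a i)\<bar>)
      + (\<Sum>i\<in>I. \<bar>N i / n - (\<alpha> i + N i) / (T + n)\<bar>)"
    unfolding sum.distrib by (subst sum.group[OF I]) (use I in auto)
  finally show ?thesis using prior by linarith
qed

lemma sum_card_cells:
  fixes y :: "nat \<Rightarrow> real^'d"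
  assumes "0 < b" and "J \<subseteq> multi_idx b"
  shows "(\<Sum>i\<in>J. real (card {t\<in>{1..n}. y t \<in> cell i b})) = real (card {t\<in>{1..n}. y t \<in> (\<Union>i\<in>J. cell i b)})"
proof -
  have J: "finite J" using assms(2) finite_multi_idx finite_subset by blast
  have "card (\<Union>i\<in>J. {t\<in>{1..n}. y t \<in> cell i b}) = (\<Sum>i\<in>J. card {t\<in>{1..n}. y t \<in> cell i b})"
    using disjoint_cells[OF assms(1), where 'd = 'd] assms(2) J
    by (intro card_UN_disjoint) (auto simp: disjoint_family_on_def)
  moreover have "(\<Union>i\<in>J. {t\<in>{1..n}. y t \<in> cell i b}) = {t\<in>{1..n}. y t \<in> (\<Union>i\<in>J. cell i b)}" by auto
  ultimately show ?thesis by simp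
qed

text \<open>Cauchy-Schwarz in disguise: \<open>\<bar>x\<bar> \<le> (x\<^sup>2 / s + s) / 2\<close> with \<open>s = 1 / sqrt (n m)\<close>,
  where \<open>m\<close> bounds the number of summands.\<close>

lemma expectation_hist_estimator_le:
  fixes M :: "'a measure" and Y :: "nat \<Rightarrow> 'a \<Rightarrow> real^'d" and P0 :: "(real^'d) measure"
    and \<alpha> :: "('d \<Rightarrow> nat) \<Rightarrow> real"
  assumes p: "1 \<le> p" and v: "1 \<le> v" and M: "prob_space M" and P0: "prob_on_cube P0"
    and Y: "\<And>t. t \<ge> 1 \<Longrightarrow> Y t \<in> borel_measurable M"
    and indep: "prob_space.indep_vars M (\<lambda>_. borel) Y {1..}"
    and dist: "\<And>t. t \<ge> 1 \<Longrightarrow> distr M borel (Y t) = P0"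
    and \<alpha>: "\<And>j. j \<in> multi_idx (2 ^ K) \<Longrightarrow> 0 \<le> \<alpha> j" and n: "1 \<le> n"
  shows "(\<integral>\<^sup>+\<omega>. ennreal (wasserstein p v P0 (hist_estimator (2 ^ K) \<alpha> (\<lambda>t. Y t \<omega>) n)) \<partial>M)
    \<le> ennreal ((real CARD('d) powr v * ((1 / 2 ^ K) powr v + (\<Sum>l<K. (2 ^ Suc l / 2 ^ K) powr v *
      ((sqrt (2 ^ ((K - l) * CARD('d)) / real n) + 2 * sum \<alpha> (multi_idx (2 ^ K)) / real n) / 2)))) powr (1/v))"
proof -
  interpret prob_space M by fact
  interpret P0: prob_space P0 using P0 by (simp add: prob_on_cube_def)
  have sP0: "sets P0 = sets borel" using P0 by (simp add: prob_on_cube_def)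
  define I where "I = (multi_idx (2 ^ K) :: ('d \<Rightarrow> nat) set)"
  have I: "finite I" by (simp add: I_def)
  define T where "T = sum \<alpha> I"
  have T0: "0 \<le> T" unfolding T_def using \<alpha> by (auto simp: I_def intro: sum_nonneg)
  define J where "J l q = {i\<in>I. ancestor l i = q}" for l and q :: "'d \<Rightarrow> nat"
  define B where "B l q = (\<Union>i\<in>J l q. cell i (2 ^ K) :: (real^'d) set)" for l q
  have finJ: "finite (J l q)" for l q using I by (simp add: J_def)
  have B: "B l q \<in> sets borel" for l q unfolding B_def using finJ by (intro sets.finite_UN) auto
  define X where "X l q \<omega> = real (card {t\<in>{1..n}. Y t \<omega> \<in> B l q}) / real n - measure P0 (B l q)" for l q \<omega>
  have X2: "integrable M (\<lambda>\<omega>. (X l q \<omega>)\<^sup>2)" "expectation (\<lambda>\<omega>. (X l q \<omega>)\<^sup>2) \<le> measure P0 (B l q) / real n" for l q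
    unfolding X_def using empirical_second_moment[OF Y indep dist B n] by auto
  define s where "s l = 1 / sqrt (real n * 2 ^ ((K - l) * CARD('d)))" for l
  have s: "0 < s l" for l using n by (simp add: s_def)
  define c where "c l = (2 ^ Suc l / 2 ^ K) powr v" for l :: nat
  \<comment> \<open>The deterministic bound as an increasing affine function of the empirical
    discrepancies of the levels, so that it commutes with the expectation.\<close>
  define L where "L g = real CARD('d) powr v * ((1 / 2 ^ K) powr v + (\<Sum>l<K. c l * ((g l + 2 * T / real n) / 2)))" for g
  have L_mono: "L g \<le> L h" if "\<And>l. l < K \<Longrightarrow> g l \<le> h l" for g h
    unfolding L_def c_def using that
    by (intro mult_left_mono add_left_mono sum_mono divide_right_mono add_right_mono) auto
  \<comment> \<open>The width term is positive by itself, so the bound meets the strict positivity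
    required by \<open>nn_integral_root_le\<close>.\<close>
  have L_pos: "0 < L g" if "\<And>l. 0 \<le> g l" for g
    unfolding L_def c_def using that T0
    by (intro mult_pos_pos add_pos_nonneg sum_nonneg mult_nonneg_nonneg) auto
  \<comment> \<open>A quadratic majorant of the empirical discrepancy of level \<open>l\<close>; its
    expectation involves only second moments.\<close>
  define g where "g \<omega> l = (\<Sum>q\<in>ancestor l ` I. ((X l q \<omega>)\<^sup>2 / s l + s l) / 2)" for \<omega> l
  have g0: "0 \<le> g \<omega> l" for \<omega> l using s[of l] by (auto simp: g_def intro!: sum_nonneg)
  have ig: "integrable M (\<lambda>\<omega>. g \<omega> l)" for l unfolding g_def using X2(1) by simp
  have Eg: "expectation (\<lambda>\<omega>. g \<omega> l) \<le> sqrt (2 ^ ((K - l) * CARD('d)) / real n)" if l: "l < K" for l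
  proof -
    define m :: real where "m = 2 ^ ((K - l) * CARD('d))"
    have m: "0 < m" by (simp add: m_def)
    have "expectation (\<lambda>\<omega>. g \<omega> l) = (\<Sum>q\<in>ancestor l ` I. (expectation (\<lambda>\<omega>. (X l q \<omega>)\<^sup>2) / s l + s l) / 2)"
      unfolding g_def using X2(1) by (simp add: prob_space)
    also have "\<dots> \<le> (\<Sum>q\<in>ancestor l ` I. (measure P0 (B l q) / real n / s l + s l) / 2)"
      using X2(2) s[of l] by (intro sum_mono divide_right_mono add_right_mono) auto
    also have "\<dots> = ((\<Sum>q\<in>ancestor l ` I. measure P0 (B l q)) / real n / s l + real (card (ancestor l ` I)) * s l) / 2"
      by (simp add: sum.distrib sum_divide_distrib[symmetric])
    also have "\<dots> \<le> (1 / real n / s l + m * s l) / 2"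
    proof -
      have "(\<Sum>q\<in>ancestor l ` I. measure P0 (B l q)) = (\<Sum>q\<in>ancestor l ` I. \<Sum>i\<in>J l q. measure P0 (cell i (2 ^ K)))"
      proof (intro sum.cong refl)
        fix q show "measure P0 (B l q) = (\<Sum>i\<in>J l q. measure P0 (cell i (2 ^ K)))"
          unfolding B_def using finJ disjoint_cells[of "2 ^ K", where 'd = 'd]
          by (intro P0.finite_measure_finite_Union) (auto simp: sP0 J_def I_def disjoint_family_on_def)
      qed
      also have "\<dots> = (\<Sum>i\<in>I. measure P0 (cell i (2 ^ K)))"
        unfolding J_def using I by (intro sum.group) auto
      also have "\<dots> = 1" unfolding I_def using P0 by (rule prob_on_cube_measure_cells) simp
      finally have one: "(\<Sum>q\<in>ancestor l ` I. measure P0 (B l q)) = 1" .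
      have "real (card (ancestor l ` I)) \<le> real (2 ^ ((K - l) * CARD('d)))"
        unfolding I_def of_nat_le_iff using l by (intro card_ancestor_le) simp
      then show ?thesis unfolding one m_def
        using s[of l] by (intro divide_right_mono add_left_mono mult_right_mono) auto
    qed
    \<comment> \<open>With this \<open>s l\<close> both halves have the same value, which is the
      optimal balance.\<close>
    also have "\<dots> = sqrt (m / real n)"
    proof -
      have "1 / real n / s l = sqrt (m / real n)" "m * s l = sqrt (m / real n)"
        unfolding s_def m_def[symmetric] using n m
        by (simp_all add: real_sqrt_mult real_sqrt_divide field_simps)
      then show ?thesis by simp
    qed
    finally show ?thesis by (simp add: m_def)
  qed
  have W: "AE \<omega> in M. wasserstein p v P0 (hist_estimator (2 ^ K) \<alpha> (\<lambda>t. Y t \<omega>) n) \<le> L (g \<omega>) powr (1/v)"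
  proof -
    \<comment> \<open>Almost surely every observation falls into some cell, so the counts add up to
      n and the estimator has denominator T + n.\<close>
    have "AE \<omega> in M. Y t \<omega> \<in> unit_cube" if "t \<in> {1..n}" for t
    proof -
      have "distr M borel (Y t) = P0" using dist that by simp
      then have "AE x in distr M borel (Y t). x \<in> unit_cube" by (simp only: AE_unit_cube[OF P0])
      then show ?thesis using Y that by (subst (asm) AE_distr_iff) auto
    qed
    then have "AE \<omega> in M. \<forall>t\<in>{1..n}. Y t \<omega> \<in> unit_cube" by (subst AE_finite_all) auto
    then show ?thesis
    proof eventually_elim
      fix \<omega> assume cube: "\<forall>t\<in>{1..n}. Y t \<omega> \<in> unit_cube"
      define N where "N i = real (card {t\<in>{1..n}. Y t \<omega> \<in> cell i (2 ^ K)})" for i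
      have "{t\<in>{1..n}. Y t \<omega> \<in> (\<Union>i\<in>I. cell i (2 ^ K))} = {1..n}"
        unfolding I_def using cube by (subst Union_cells) auto
      then have sumN: "sum N I = real n"
        unfolding N_def using sum_card_cells[of "2 ^ K" I n "\<lambda>t. Y t \<omega>"] by (simp add: I_def)
      have total: "(\<Sum>j\<in>I. post_conc (2 ^ K) \<alpha> (\<lambda>t. Y t \<omega>) n j) = T + real n"
        using sumN by (simp add: post_conc_def T_def N_def sum.distrib)
      define w where "w i = (\<alpha> i + N i) / (T + real n)" for i
      have est: "hist_estimator (2 ^ K) \<alpha> (\<lambda>t. Y t \<omega>) n = histogram (2 ^ K) w"
        unfolding hist_estimator_def total[unfolded I_def]
        by (simp add: w_def[abs_def] post_conc_def N_def)
      have w0: "0 \<le> w i" if "i \<in> I" for i using \<alpha> T0 that by (simp add: w_def N_def I_def)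
      have w1: "sum w I = 1"
        using sumN T0 n by (simp add: w_def sum_divide_distrib[symmetric] sum.distrib T_def[symmetric])
      \<comment> \<open>The subtracted prior term is the one that \<open>L\<close> adds
        back.\<close>
      have "wasserstein p v P0 (histogram (2 ^ K) w) \<le>
          L (\<lambda>l. (\<Sum>q\<in>ancestor l ` I. \<bar>\<Sum>i\<in>J l q. measure P0 (cell i (2 ^ K)) - w i\<bar>) - 2 * T / real n) powr (1/v)"
        using wasserstein_histogram_le[OF p v P0, of K w] w0 w1
        unfolding L_def c_def J_def I_def by simp
      also have "\<dots> \<le> L (g \<omega>) powr (1/v)"
      proof (intro powr_mono2 L_mono)
        show "0 \<le> 1 / v" using v by simp
        show "0 \<le> L (\<lambda>l. (\<Sum>q\<in>ancestor l ` I. \<bar>\<Sum>i\<in>J l q. measure P0 (cell i (2 ^ K)) - w i\<bar>) - 2 * T / real n)"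
          unfolding L_def c_def by (auto intro!: mult_nonneg_nonneg add_nonneg_nonneg sum_nonneg)
        fix l
        have X: "(\<Sum>i\<in>J l q. N i) / real n - (\<Sum>i\<in>J l q. measure P0 (cell i (2 ^ K))) = X l q \<omega>" for q
        proof -
          have "(\<Sum>i\<in>J l q. N i) = real (card {t\<in>{1..n}. Y t \<omega> \<in> B l q})"
            unfolding N_def B_def by (rule sum_card_cells) (auto simp: J_def I_def)
          moreover have "measure P0 (B l q) = (\<Sum>i\<in>J l q. measure P0 (cell i (2 ^ K)))"
            unfolding B_def using finJ disjoint_cells[of "2 ^ K", where 'd = 'd]
            by (intro P0.finite_measure_finite_Union) (auto simp: sP0 J_def I_def disjoint_family_on_def)
          ultimately show ?thesis by (simp add: X_def)
        qed
        have "(\<Sum>q\<in>ancestor l ` I. \<bar>\<Sum>i\<in>J l q. measure P0 (cell i (2 ^ K)) - w i\<bar>)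
            \<le> (\<Sum>q\<in>ancestor l ` I. \<bar>(\<Sum>i\<in>J l q. N i) / real n - (\<Sum>i\<in>J l q. measure P0 (cell i (2 ^ K)))\<bar>) + 2 * T / real n"
          unfolding w_def J_def using I \<alpha> sumN n
          by (intro posterior_mean_diff) (auto simp: I_def N_def T_def)
        also have "\<dots> \<le> g \<omega> l + 2 * T / real n"
          unfolding X g_def
        proof (intro add_right_mono sum_mono)
          fix q
          have "0 \<le> (\<bar>X l q \<omega>\<bar> - s l)\<^sup>2" by simp
          then have "2 * \<bar>X l q \<omega>\<bar> * s l \<le> (X l q \<omega>)\<^sup>2 + (s l)\<^sup>2" by (simp add: power2_diff)
          then show "\<bar>X l q \<omega>\<bar> \<le> ((X l q \<omega>)\<^sup>2 / s l + s l) / 2"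
            using s[of l] by (simp add: field_simps power2_eq_square)
        qed
        finally show "(\<Sum>q\<in>ancestor l ` I. \<bar>\<Sum>i\<in>J l q. measure P0 (cell i (2 ^ K)) - w i\<bar>) - 2 * T / real n \<le> g \<omega> l"
          by simp
      qed
      finally show "wasserstein p v P0 (hist_estimator (2 ^ K) \<alpha> (\<lambda>t. Y t \<omega>) n) \<le> L (g \<omega>) powr (1/v)"
        unfolding est .
    qed
  qed
  have iL: "integrable M (\<lambda>\<omega>. L (g \<omega>))" unfolding L_def using ig by simp
  have "expectation (\<lambda>\<omega>. L (g \<omega>)) = L (\<lambda>l. expectation (\<lambda>\<omega>. g \<omega> l))"
    unfolding L_def using ig by (simp add: prob_space)
  also have "\<dots> \<le> L (\<lambda>l. sqrt (2 ^ ((K - l) * CARD('d)) / real n))"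
    using Eg by (rule L_mono)
  finally have "expectation (\<lambda>\<omega>. L (g \<omega>)) \<le> L (\<lambda>l. sqrt (2 ^ ((K - l) * CARD('d)) / real n))" .
  then have "(\<integral>\<^sup>+\<omega>. ennreal (wasserstein p v P0 (hist_estimator (2 ^ K) \<alpha> (\<lambda>t. Y t \<omega>) n)) \<partial>M)
      \<le> ennreal (L (\<lambda>l. sqrt (2 ^ ((K - l) * CARD('d)) / real n)) powr (1/v))"
    using iL W v L_pos g0 by (intro nn_integral_root_le[of "\<lambda>\<omega>. L (g \<omega>)"]) (auto intro: less_imp_le)
  then show ?thesis by (simp add: L_def c_def T_def I_def)
qed

subsection \<open>Rates\<close>

text \<open>Reindexed by depth k = K - 1 - l, the empirical terms form a geometric series with ratio
  2 powr (d/2 - v). The factor 2 powr (d/2) appears because the discrepancy is taken one level below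
  the cells in which mass moves.\<close>

lemma dyadic_sum_le:
  fixes d K n :: nat and v T :: real
  assumes v: "1 \<le> v" and n: "1 \<le> n" and T: "0 \<le> T"
  shows "(\<Sum>l<K. (2 ^ Suc l / 2 ^ K) powr v * ((sqrt (2 ^ ((K - l) * d) / real n) + 2 * T / real n) / 2))
    \<le> 2 * T / real n + 2 powr (real d / 2) / 2 * real n powr (-1/2) * (\<Sum>k<K. (2 powr (real d / 2 - v)) ^ k)"
proof -
  define g where "g k = (1 / 2 ^ k) powr v * ((sqrt (2 ^ (Suc k * d) / real n) + 2 * T / real n) / 2)" for k :: nat
  have "(\<Sum>l<K. (2 ^ Suc l / 2 ^ K) powr v * ((sqrt (2 ^ ((K - l) * d) / real n) + 2 * T / real n) / 2))
      = (\<Sum>l<K. g (K - Suc l))"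
  proof (intro sum.cong refl)
    fix l assume "l \<in> {..<K}"
    then have K: "K = Suc l + (K - Suc l)" "K - l = Suc (K - Suc l)" by auto
    have "(2::real) ^ Suc l / 2 ^ K = 1 / 2 ^ (K - Suc l)"
      by (subst K(1), subst power_add) simp
    then show "(2 ^ Suc l / 2 ^ K) powr v * ((sqrt (2 ^ ((K - l) * d) / real n) + 2 * T / real n) / 2) = g (K - Suc l)"
      unfolding g_def K(2) by simp
  qed
  also have "\<dots> = (\<Sum>k<K. g k)" by (rule sum.nat_diff_reindex)
  also have "\<dots> \<le> (\<Sum>k<K. T / real n * (1/2) ^ k + 2 powr (real d / 2) / 2 * real n powr (-1/2) * (2 powr (real d / 2 - v)) ^ k)"
  proof (rule sum_mono)
    \<comment> \<open>As v is at least 1, the prior terms are dominated by T/n times (1/2) ^ k,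
      whose sum is at most 2 T/n whatever v and K are.\<close>
    fix k
    have "(1 / 2 ^ k :: real) powr v \<le> (1 / 2 ^ k) powr 1"
      using v by (intro powr_mono') (auto simp: divide_le_eq)
    then have "(1 / 2 ^ k) powr v * (T / real n) \<le> (1/2) ^ k * (T / real n)"
      using T by (intro mult_right_mono) (auto simp: power_one_over)
    moreover have "(1 / 2 ^ k) powr v * sqrt (2 ^ (Suc k * d) / real n)
        = 2 powr (real d / 2) * real n powr (-1/2) * (2 powr (real d / 2 - v)) ^ k"
    proof -
      have "(1 / 2 ^ k :: real) powr v = 2 powr (- real k * v)"
        by (simp add: powr_realpow[symmetric] powr_minus_divide[symmetric] powr_powr)
      moreover have "sqrt (2 ^ (Suc k * d) / real n) = 2 powr (real (Suc k * d) / 2) * real n powr (-1/2)"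
        using n by (simp add: powr_half_sqrt[symmetric] powr_divide powr_realpow[symmetric] powr_powr powr_minus divide_simps del: mult_Suc of_nat_mult)
      moreover have "(2 powr (real d / 2 - v)) ^ k = 2 powr ((real d / 2 - v) * real k)"
        by (simp add: powr_realpow[symmetric] powr_powr)
      moreover have "2 powr (- real k * v) * 2 powr (real (Suc k * d) / 2)
          = 2 powr (real d / 2) * 2 powr ((real d / 2 - v) * real k)"
        unfolding powr_add[symmetric] by (rule arg_cong[where f = "\<lambda>x. 2 powr x"]) (simp add: field_simps)
      ultimately show ?thesis by (simp add: mult_ac)
    qed
    ultimately show "g k \<le> T / real n * (1/2) ^ k + 2 powr (real d / 2) / 2 * real n powr (-1/2) * (2 powr (real d / 2 - v)) ^ k"
      unfolding g_def by (simp add: distrib_left add_divide_distrib mult.commute)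
  qed
  also have "\<dots> = T / real n * (\<Sum>k<K. (1/2) ^ k) + 2 powr (real d / 2) / 2 * real n powr (-1/2) * (\<Sum>k<K. (2 powr (real d / 2 - v)) ^ k)"
    by (simp add: sum.distrib sum_distrib_left)
  also have "(\<Sum>k<K. (1/2::real) ^ k) \<le> 2" by (simp add: sum_gp_strict)
  then have "T / real n * (\<Sum>k<K. (1/2) ^ k) \<le> T / real n * 2" using T by (intro mult_left_mono) auto
  finally show ?thesis by simp
qed

text \<open>Rounding up to a power of two costs at most a factor 2. The three bounds serve, in turn,
  the cell width, the term r ^ K of the growing series, and the number of levels in the critical
  case.\<close>

lemma
  fixes x :: real
  assumes "1 \<le> x"
  shows le_two_power_ceiling_log: "x \<le> 2 ^ nat \<lceil>log 2 x\<rceil>"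
    and two_power_ceiling_log_le: "2 ^ nat \<lceil>log 2 x\<rceil> \<le> 2 * x"
    and nat_ceiling_log_le: "real (nat \<lceil>log 2 x\<rceil>) \<le> log 2 x + 1"
proof -
  have 0: "0 \<le> log 2 x" using assms by simp
  then have K: "real (nat \<lceil>log 2 x\<rceil>) = of_int \<lceil>log 2 x\<rceil>" by simp
  show le: "real (nat \<lceil>log 2 x\<rceil>) \<le> log 2 x + 1" unfolding K by linarith
  have "x = 2 powr log 2 x" using assms by simp
  also have "\<dots> \<le> 2 powr real (nat \<lceil>log 2 x\<rceil>)" unfolding K by (intro powr_mono) auto
  finally show "x \<le> 2 ^ nat \<lceil>log 2 x\<rceil>" by (simp add: powr_realpow)
  have "2 powr real (nat \<lceil>log 2 x\<rceil>) \<le> 2 powr (log 2 x + 1)" using le by (intro powr_mono) auto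
  moreover have "2 powr real (nat \<lceil>log 2 x\<rceil>) = 2 ^ nat \<lceil>log 2 x\<rceil>" by (rule powr_realpow) simp
  moreover have "2 powr (log 2 x + 1) = 2 * x" using assms by (simp add: powr_add)
  ultimately show "2 ^ nat \<lceil>log 2 x\<rceil> \<le> 2 * x" by simp
qed

text \<open>Width, prior and empirical terms are each bounded by a constant times \<open>R\<close>,
  the v-th power of the target rate, and the root is taken last. The constant is fixed before n and
  T.\<close>

lemma rate_bound:
  fixes d :: nat and v A :: real
  assumes d: "1 \<le> d" and v: "1 \<le> v" and A: "0 < A"
  shows "\<exists>C>0. \<forall>n\<ge>3. \<forall>T. 0 \<le> T \<longrightarrow>
    T \<le> (if real d \<le> 2 * v then A * real n powr (1/2) else A * real n powr (1 - v / real d)) \<longrightarrow>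
    (let K = nat \<lceil>log 2 (k_seq d v n)\<rceil> in
      (real d powr v * ((1 / 2 ^ K) powr v + (\<Sum>l<K. (2 ^ Suc l / 2 ^ K) powr v *
      ((sqrt (2 ^ ((K - l) * d) / real n) + 2 * T / real n) / 2)))) powr (1/v))
    \<le> (if real d < 2 * v then C * real n powr (-1/(2 * v))
        else if real d = 2 * v then C * real n powr (-1/(2 * v)) * ln (real n) powr (1/v)
        else C * real n powr (-1 / real d))"
proof -
  define r where "r = 2 powr (real d / 2 - v)"
  define H where "H = 2 powr (real d / 2) / 2"
  have r0: "0 < r" and H0: "0 < H" by (auto simp: r_def H_def)
  \<comment> \<open>Constants of the geometric sum: the full series for r < 1, the count K bounded
    via log 2 k + 1 for r = 1, and r / (r - 1) for r > 1, whose numerator r pays for the rounding of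
    K.\<close>
  define E where "E = (if real d < 2 * v then 1 / (1 - r) else if real d = 2 * v then 1 / (2 * v * ln 2) + 1 else r / (r - 1))"
  have E0: "0 \<le> E"
  proof -
    have "r < 1" if "real d < 2 * v" using that by (simp add: r_def powr_less_one)
    moreover have "1 < r" if "real d > 2 * v" using that by (simp add: r_def)
    ultimately show ?thesis using v r0 by (auto simp: E_def)
  qed
  \<comment> \<open>The summands 1, 2 A and H E come from width, prior and empirical part.\<close>
  define C where "C = real d powr v * (1 + 2 * A + H * E)"
  have C0: "0 < C" unfolding C_def using d A H0 E0 by (intro mult_pos_pos add_pos_nonneg) auto
  show ?thesis
  proof (intro exI[of _ "C powr (1/v)"] conjI allI impI)
    show "0 < C powr (1/v)" using C0 by simp
    fix n :: nat and T :: real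
    assume n: "3 \<le> n" and T0: "0 \<le> T"
      and T: "T \<le> (if real d \<le> 2 * v then A * real n powr (1/2) else A * real n powr (1 - v / real d))"
    define k where "k = k_seq d v n"
    define K where "K = nat \<lceil>log 2 k\<rceil>"
    define R where "R = (if real d < 2 * v then real n powr (-1/2) else if real d = 2 * v
      then real n powr (-1/2) * ln (real n) else real n powr (- v / real d))"
    \<comment> \<open>The reason for the threshold 3: in the critical case a logarithm of at least 1
      absorbs the terms that carry none.\<close>
    have ln1: "1 \<le> ln (real n)"
    proof -
      have "exp 1 \<le> real n" using e_less_272 n by linarith
      then show ?thesis using n by (subst ln_ge_iff) auto
    qed
    have R0: "0 < R" using n ln1 by (auto simp: R_def)
    have k1: "1 \<le> k" using n v unfolding k_def k_seq_def by (auto intro!: ge_one_powr_ge_zero)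
    note K = le_two_power_ceiling_log[OF k1, folded K_def] two_power_ceiling_log_le[OF k1, folded K_def]
      nat_ceiling_log_le[OF k1, folded K_def]
    have width: "(1 / 2 ^ K) powr v \<le> R"
    proof -
      have "(1 / 2 ^ K) powr v \<le> (1 / k) powr v"
        using K(1) k1 v by (intro powr_mono2 divide_left_mono) auto
      also have "\<dots> = k powr (-v)" using k1 by (simp add: powr_divide powr_minus_divide)
      also have "\<dots> = (if real d \<le> 2 * v then real n powr (-1/2) else real n powr (- v / real d))"
        using v by (auto simp: k_def k_seq_def powr_powr)
      also have "\<dots> \<le> R" using ln1 mult_left_mono[OF ln1, of "real n powr (-1/2)"] by (auto simp: R_def)
      finally show ?thesis .
    qed
    have prior: "T / real n \<le> A * R"
    proof -
      have sub: "real n powr x / real n = real n powr (x - 1)" for x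
        using n by (simp add: powr_diff)
      have "T / real n \<le> A * (if real d \<le> 2 * v then real n powr (1/2) else real n powr (1 - v / real d)) / real n"
        using T by (intro divide_right_mono) (auto split: if_splits)
      also have "\<dots> = A * (if real d \<le> 2 * v then real n powr (-1/2) else real n powr (- v / real d))"
        using sub[of "1/2"] sub[of "1 - v / real d"] by (simp flip: times_divide_eq_right)
      also have "\<dots> \<le> A * R" using A ln1 mult_left_mono[OF ln1, of "real n powr (-1/2)"]
        by (intro mult_left_mono) (auto simp: R_def)
      finally show ?thesis .
    qed
    have geo: "real n powr (-1/2) * (\<Sum>k<K. r ^ k) \<le> E * R"
    proof -
      consider "real d < 2 * v" | "real d = 2 * v" | "real d > 2 * v" by linarith
      then show ?thesis
      proof cases
        case 1
        then have r1: "r < 1" by (simp add: r_def powr_less_one)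
        have "(\<Sum>k<K. r ^ k) \<le> 1 / (1 - r)"
          using r0 r1 by (simp add: sum_gp_strict divide_right_mono)
        then have "real n powr (-1/2) * (\<Sum>k<K. r ^ k) \<le> real n powr (-1/2) * (1 / (1 - r))"
          by (rule mult_left_mono) simp
        then show ?thesis using 1 by (simp add: E_def R_def)
      next
        case 2
        then have "(\<Sum>k<K. r ^ k) = real K" by (simp add: r_def)
        also have "\<dots> \<le> log 2 k + 1" by (rule K(3))
        also have "log 2 k = ln (real n) / (2 * v * ln 2)"
          using 2 n by (simp add: k_def k_seq_def log_def ln_powr)
        also have "\<dots> + 1 \<le> E * ln (real n)"
          using 2 ln1 by (simp add: E_def distrib_right)
        finally have "real n powr (-1/2) * (\<Sum>k<K. r ^ k) \<le> real n powr (-1/2) * (E * ln (real n))"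
          by (rule mult_left_mono) simp
        then show ?thesis using 2 by (simp add: R_def mult_ac)
      next
        case 3
        then have r1: "1 < r" by (simp add: r_def)
        \<comment> \<open>Here the upper bound 2 ^ K \<le> 2 k is essential, as r ^ K grows with
          K.\<close>
        have "r ^ K = (2 ^ K) powr (real d / 2 - v)"
          by (simp add: r_def powr_realpow[symmetric] powr_powr mult.commute)
        also have "\<dots> \<le> (2 * k) powr (real d / 2 - v)" using 3 K(2) by (intro powr_mono2) auto
        also have "\<dots> = r * real n powr ((real d / 2 - v) / real d)"
          using 3 by (simp add: r_def powr_mult k_def k_seq_def powr_powr)
        finally have rK: "r ^ K \<le> r * real n powr ((real d / 2 - v) / real d)" .
        have "(\<Sum>k<K. r ^ k) = (r ^ K - 1) / (r - 1)"
          using r1 by (simp add: geometric_sum)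
        also have "\<dots> \<le> r * real n powr ((real d / 2 - v) / real d) / (r - 1)"
          using rK r1 by (intro divide_right_mono) auto
        finally have "real n powr (-1/2) * (\<Sum>k<K. r ^ k)
            \<le> real n powr (-1/2) * (r * real n powr ((real d / 2 - v) / real d) / (r - 1))"
          by (rule mult_left_mono) simp
        also have "\<dots> = E * (real n powr (-1/2) * real n powr ((real d / 2 - v) / real d))"
          using 3 by (simp add: E_def)
        \<comment> \<open>The exponents add up: -1/2 + (1/2 - v/d) = -v/d.\<close>
        also have "real n powr (-1/2) * real n powr ((real d / 2 - v) / real d) = R"
          unfolding powr_add[symmetric] using 3 d by (simp add: R_def field_simps)
        finally show ?thesis .
      qed
    qed
    define S where "S = (\<Sum>l<K. (2 ^ Suc l / 2 ^ K) powr v * ((sqrt (2 ^ ((K - l) * d) / real n) + 2 * T / real n) / 2))"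
    have "S \<le> 2 * (T / real n) + H * (real n powr (-1/2) * (\<Sum>k<K. r ^ k))"
      using dyadic_sum_le[OF v _ T0, of n K d] n unfolding S_def H_def r_def by (simp add: mult.assoc)
    also have "\<dots> \<le> 2 * (A * R) + H * (E * R)"
      using prior geo H0 by (intro add_mono mult_left_mono) auto
    finally have S: "S \<le> 2 * (A * R) + H * (E * R)" .
    have S0: "0 \<le> S" unfolding S_def using T0 by (intro sum_nonneg) auto
    have "(real d powr v * ((1 / 2 ^ K) powr v + S)) powr (1/v) \<le> (C * R) powr (1/v)"
    proof (intro powr_mono2)
      have "real d powr v * ((1 / 2 ^ K) powr v + S) \<le> real d powr v * (R + (2 * (A * R) + H * (E * R)))"
        using width S by (intro mult_left_mono add_mono) auto
      then show "real d powr v * ((1 / 2 ^ K) powr v + S) \<le> C * R" by (simp add: C_def algebra_simps)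
    qed (use v S0 in auto)
    also have "(C * R) powr (1/v) = C powr (1/v) * R powr (1/v)" by (rule powr_mult)
    also have "R powr (1/v) = (if real d < 2 * v then real n powr (-1/(2 * v))
        else if real d = 2 * v then real n powr (-1/(2 * v)) * ln (real n) powr (1/v)
        else real n powr (-1 / real d))"
      using v by (auto simp: R_def powr_mult powr_powr)
    finally show "(let K = nat \<lceil>log 2 (k_seq d v n)\<rceil> in
      (real d powr v * ((1 / 2 ^ K) powr v + (\<Sum>l<K. (2 ^ Suc l / 2 ^ K) powr v *
      ((sqrt (2 ^ ((K - l) * d) / real n) + 2 * T / real n) / 2)))) powr (1/v))
    \<le> (if real d < 2 * v then C powr (1/v) * real n powr (-1/(2 * v))
        else if real d = 2 * v then C powr (1/v) * real n powr (-1/(2 * v)) * ln (real n) powr (1/v)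
        else C powr (1/v) * real n powr (-1 / real d))"
      unfolding Let_def k_def[symmetric] K_def[symmetric] S_def[symmetric] by (simp split: if_splits)
  qed
qed

theorem theorem1:
  fixes M :: "'a measure" and Y :: "nat \<Rightarrow> 'a \<Rightarrow> real^'d"
    and P0 :: "(real^'d) measure" and p v :: real
    and al :: "nat \<Rightarrow> ('d \<Rightarrow> nat) \<Rightarrow> real"
  assumes "1 \<le> p" and "1 \<le> v"
    and "prob_space M"
    and "prob_on_cube P0"
    and "\<And>t. t \<ge> 1 \<Longrightarrow> Y t \<in> borel_measurable M"
    and "prob_space.indep_vars M (\<lambda>_. borel) Y {1..}"
    and "\<And>t. t \<ge> 1 \<Longrightarrow> distr M borel (Y t) = P0"
    and "\<And>n j. j \<in> multi_idx (b_seq CARD('d) v n) \<Longrightarrow> 0 \<le> al n j"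
    and "\<exists>A>0. \<forall>n\<ge>1. (\<Sum>j\<in>multi_idx (b_seq CARD('d) v n). al n j)
           \<le> (if real CARD('d) \<le> 2 * v then A * real n powr (1/2)
              else A * real n powr (1 - v / real CARD('d)))"
  shows "\<exists>C>0. \<exists>N::nat. \<forall>n\<ge>N.
     (\<integral>\<^sup>+ \<omega>. ennreal (wasserstein p v P0
        (hist_estimator (b_seq CARD('d) v n) (al n) (\<lambda>t. Y t \<omega>) n)) \<partial>M)
     \<le> ennreal (if real CARD('d) < 2 * v then C * real n powr (-1/(2 * v))
        else if real CARD('d) = 2 * v then C * real n powr (-1/(2 * v)) * ln (real n) powr (1/v)
        else C * real n powr (-1 / real CARD('d)))"
proof -
  let ?T = "\<lambda>n. sum (al n) (multi_idx (b_seq CARD('d) v n))"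
  obtain A where A: "0 < A" "\<And>n. 1 \<le> n \<Longrightarrow> ?T n \<le> (if real CARD('d) \<le> 2 * v then A * real n powr (1/2)
      else A * real n powr (1 - v / real CARD('d)))"
    using assms(9) by auto
  have d: "1 \<le> CARD('d)" by (simp add: Suc_leI)
  obtain C where C: "0 < C" and bound: "\<forall>n\<ge>3. \<forall>T. 0 \<le> T \<longrightarrow>
    T \<le> (if real CARD('d) \<le> 2 * v then A * real n powr (1/2) else A * real n powr (1 - v / real CARD('d))) \<longrightarrow>
    (let K = nat \<lceil>log 2 (k_seq CARD('d) v n)\<rceil> in
      (real CARD('d) powr v * ((1 / 2 ^ K) powr v + (\<Sum>l<K. (2 ^ Suc l / 2 ^ K) powr v *
      ((sqrt (2 ^ ((K - l) * CARD('d)) / real n) + 2 * T / real n) / 2)))) powr (1/v))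
    \<le> (if real CARD('d) < 2 * v then C * real n powr (-1/(2 * v))
        else if real CARD('d) = 2 * v then C * real n powr (-1/(2 * v)) * ln (real n) powr (1/v)
        else C * real n powr (-1 / real CARD('d)))"
    using rate_bound[OF d assms(2) A(1)] by blast
  show ?thesis
  \<comment> \<open>The constant and the threshold 3 are those of \<open>rate_bound\<close>.\<close>
  proof (intro exI[of _ C] exI[of _ 3] conjI allI impI)
    show "0 < C" by (rule C)
    fix n :: nat assume n: "3 \<le> n"
    define K where "K = nat \<lceil>log 2 (k_seq CARD('d) v n)\<rceil>"
    have b: "b_seq CARD('d) v n = 2 ^ K" by (simp add: b_seq_def K_def)
    have al: "\<And>j. j \<in> multi_idx (2 ^ K) \<Longrightarrow> 0 \<le> al n j" using assms(8)[of _ n] unfolding b .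
    have T0: "0 \<le> ?T n" using assms(8) by (rule sum_nonneg)
    have "(\<integral>\<^sup>+ \<omega>. ennreal (wasserstein p v P0 (hist_estimator (2 ^ K) (al n) (\<lambda>t. Y t \<omega>) n)) \<partial>M)
      \<le> ennreal ((real CARD('d) powr v * ((1 / 2 ^ K) powr v + (\<Sum>l<K. (2 ^ Suc l / 2 ^ K) powr v *
        ((sqrt (2 ^ ((K - l) * CARD('d)) / real n) + 2 * sum (al n) (multi_idx (2 ^ K)) / real n) / 2)))) powr (1/v))"
      using n by (intro expectation_hist_estimator_le assms al) auto
    also have "\<dots> \<le> ennreal (if real CARD('d) < 2 * v then C * real n powr (-1/(2 * v))
        else if real CARD('d) = 2 * v then C * real n powr (-1/(2 * v)) * ln (real n) powr (1/v)
        else C * real n powr (-1 / real CARD('d)))"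
      using bound[rule_format, OF n T0] A(2)[of n] n
      unfolding Let_def K_def[symmetric] b by (intro ennreal_leI) auto
    finally show "(\<integral>\<^sup>+ \<omega>. ennreal (wasserstein p v P0
        (hist_estimator (b_seq CARD('d) v n) (al n) (\<lambda>t. Y t \<omega>) n)) \<partial>M)
      \<le> ennreal (if real CARD('d) < 2 * v then C * real n powr (-1/(2 * v))
        else if real CARD('d) = 2 * v then C * real n powr (-1/(2 * v)) * ln (real n) powr (1/v)
        else C * real n powr (-1 / real CARD('d)))"
      unfolding b .
  qed
qed

end
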